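(* Assume $\lambda_C<\mu_{\mathcal{S}(C)}$ for every nonempty $C\subseteq\mathcal{C}$. Let $X^q(t)$ be the Markov chain describing the FCFS-ALIS parallel queueing model. Conditional on the event that all servers are busy, the stationary distribution of $X^q(t)$ is given, up to a normalizing constant, by $$P^q(c^1,\dots,c^L\mid \text{all busy})\ \propto\ \prod_{\ell=1}^L\frac{\lambda_{c^\ell}}{\mu_{\mathcal{S}(\{c^1,\dots,c^\ell\})}} .$$
   Context: Customer types are $\mathcal{C}=\{c_1,\dots,c_I\}$, server types are $\mathcal{S}=\{s_1,\dots,s_J\}$, and $\mathfrak{E}\subseteq\mathcal{S}\times\mathcal{C}$ is a compatibility relation; $(s_j,c_i)\in\mathfrak{E}$ means $s_j$ can serve $c_i$. $\mathcal{S}(c_i)$ is the set of server types compatible with $c_i$; $\mathcal{S}(C)=\bigcup_{c\in C}\mathcal{S}(c)$. Every server type is compatible with at least one customer type. Rates $\lambda_{c_i}>0$, $\mu_{s_j}>0$ are given; $\lambda_C=\sum_{c\in C}\lambda_c$, $\mu_S=\sum_{s\in S}\mu_s$. Empty products equal $1$. FCFS-ALIS model: customers of type $c_i$ arrive in independent Poisson streams of rates $\lambda_{c_i}$. There are $J$ servers $s_1,\dots,s_J$; service by $s_j$ is exponential with rate $\mu_{s_j}$, all service times independent of each other and of arrivals. An arriving customer is immediately assigned to the compatible server that has been idle longest, if some compatible server is idle; otherwise it joins a single queue. A server completing a service starts serving the longest waiting compatible customer if there is one, otherwise it becomes idle. $X^q(t)=(c^1,\dots,c^L,s^1,\dots,s^K)$,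 where $c^1,\dots,c^L$ are the types of the customers waiting at time $t$ (not yet in service) ordered by arrival (oldest first), and $s^1,\dots,s^K$ are the servers idle at time $t$ ordered by idle time (longest idle first). The states are such lists in which the idle servers are distinct and each idle server is incompatible with each waiting customer. "All busy" is the event $K=0$, in which the state is just $(c^1,\dots,c^L)$, $L\ge0$. *)

theory Defs
  imports "HOL-Probability.Probability"
begin

text \<open>Continuous-time Markov chains on a discrete state space \<open>S\<close>, with time index \<open>t \<ge> 0\<close>.\<close>

definition transition_function :: "'x set \<Rightarrow> (real \<Rightarrow> 'x \<Rightarrow> 'x \<Rightarrow> real) \<Rightarrow> bool" where
  "transition_function S P \<longleftrightarrow>
     (\<forall>t\<ge>0. \<forall>x\<in>S. \<forall>y\<in>S. P t x y \<ge> 0) \<and>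
     (\<forall>t\<ge>0. \<forall>x\<in>S. ((\<lambda>y. P t x y) has_sum 1) S) \<and>
     (\<forall>x\<in>S. \<forall>y\<in>S. P 0 x y = (if x = y then 1 else 0)) \<and>
     (\<forall>s\<ge>0. \<forall>t\<ge>0. \<forall>x\<in>S. \<forall>y\<in>S. ((\<lambda>z. P s x z * P t z y) has_sum P (s + t) x y) S)"

definition has_generator :: "'x set \<Rightarrow> (real \<Rightarrow> 'x \<Rightarrow> 'x \<Rightarrow> real) \<Rightarrow> ('x \<Rightarrow> 'x \<Rightarrow> real) \<Rightarrow> bool" where
  "has_generator S P Q \<longleftrightarrow>
     (\<forall>x\<in>S. \<forall>y\<in>S. ((\<lambda>t. P t x y) has_real_derivative Q x y) (at 0 within {0..}))"

definition stationary_distribution :: "'x set \<Rightarrow> (real \<Rightarrow> 'x \<Rightarrow> 'x \<Rightarrow> real) \<Rightarrow> 'x pmf \<Rightarrow> bool" where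
  "stationary_distribution S P \<pi> \<longleftrightarrow>
     set_pmf \<pi> \<subseteq> S \<and>
     (\<forall>t\<ge>0. \<forall>y\<in>S. ((\<lambda>x. pmf \<pi> x * P t x y) has_sum pmf \<pi> y) S)"

text \<open>
  The FCFS-ALIS queue. In \<open>(ws, ids)\<close>, \<open>ws\<close> lists the types of the waiting customers, oldest
  first, and \<open>ids\<close> the idle servers, longest idle first; \<open>(s, c) \<in> E\<close> means that \<open>s\<close> can serve \<open>c\<close>.
\<close>

type_synonym ('c, 's) queue_state = "'c list \<times> 's list"

definition compatible_servers :: "('s \<times> 'c) set \<Rightarrow> 'c set \<Rightarrow> 's set" where
  "compatible_servers E C = (\<Union>c\<in>C. {s. (s, c) \<in> E})"

definition queue_states :: "('s \<times> 'c) set \<Rightarrow> ('c, 's) queue_state set" where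
  "queue_states E = {(ws, ids). distinct ids \<and> (\<forall>s\<in>set ids. \<forall>c\<in>set ws. (s, c) \<notin> E)}"

text \<open>
  As \<open>find\<close> returns the first match, the longest idle compatible server (on an arrival) or the
  longest waiting compatible customer (on a service completion) is selected and leaves its list.
\<close>

fun after_arrival :: "('s \<times> 'c) set \<Rightarrow> 'c \<Rightarrow> ('c, 's) queue_state \<Rightarrow> ('c, 's) queue_state" where
  "after_arrival E c (ws, ids) =
     (case find (\<lambda>s. (s, c) \<in> E) ids of
        Some s \<Rightarrow> (ws, remove1 s ids)
      | None \<Rightarrow> (ws @ [c], ids))"

fun after_completion :: "('s \<times> 'c) set \<Rightarrow> 's \<Rightarrow> ('c, 's) queue_state \<Rightarrow> ('c, 's) queue_state" where
  "after_completion E s (ws, ids) =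
     (case find (\<lambda>c. (s, c) \<in> E) ws of
        Some c \<Rightarrow> (remove1 c ws, ids)
      | None \<Rightarrow> (ws, ids @ [s]))"

text \<open>
  Arrivals of type \<open>c\<close> occur at rate \<open>lam c\<close>, and each busy server \<open>s\<close> (one not listed as idle)
  completes at rate \<open>mu s\<close>. Every such event changes the state, so the two sums vanish for
  \<open>x = y\<close> and the last term is the total rate of leaving \<open>x\<close>.
\<close>

definition fcfs_alis_generator ::
  "('s::finite \<times> 'c::finite) set \<Rightarrow> ('c \<Rightarrow> real) \<Rightarrow> ('s \<Rightarrow> real) \<Rightarrow>
   ('c, 's) queue_state \<Rightarrow> ('c, 's) queue_state \<Rightarrow> real" where
  "fcfs_alis_generator E lam mu x y =
     (\<Sum>c | after_arrival E c x = y. lam c)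
     + (\<Sum>s | s \<notin> set (snd x) \<and> after_completion E s x = y. mu s)
     - (if x = y then (\<Sum>c\<in>UNIV. lam c) + (\<Sum>s | s \<notin> set (snd x). mu s) else 0)"

definition fcfs_alis_chain ::
  "('s::finite \<times> 'c::finite) set \<Rightarrow> ('c \<Rightarrow> real) \<Rightarrow> ('s \<Rightarrow> real) \<Rightarrow>
   (real \<Rightarrow> ('c, 's) queue_state \<Rightarrow> ('c, 's) queue_state \<Rightarrow> real) \<Rightarrow> bool" where
  "fcfs_alis_chain E lam mu P \<longleftrightarrow>
     transition_function (queue_states E) P \<and>
     has_generator (queue_states E) P (fcfs_alis_generator E lam mu)"

definition all_busy :: "('c, 's) queue_state \<Rightarrow> bool" where
  "all_busy x \<longleftrightarrow> snd x = []"

end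

(*
  The generator has uniformly bounded rates. Hence if p satisfies the balance equations, then
  p - p P_h is o(h) in total variation; P_t being a contraction, n steps of length t/n give
  p P_t = p, without solving the Kolmogorov equations. Two stationary distributions agree because
  every state reaches the empty queue with all servers busy, while the two disjoint sets where one
  exceeds the other would both be closed and nonempty.

  The balance equations are solved by the product of the weight of the queue (as in the theorem)
  and the same weight, with the roles of customers and servers exchanged, of the list of idle
  servers. Both satisfy one insertion identity, proved by induction on the last letter: summing over
  the words that become l when some server removes its first compatible letter, and that letter
  is d, the weight flow equals the rate of d times the weight of l.
*)
theory Submission
  imports Defs
begin

section \<open>Sums over discrete distributions\<close>

text \<open>\<open>has_generator\<close> only provides derivatives at \<open>0\<close>, entry by
  entry and without uniformity, so the infinite sum that defines one step of the chain cannot be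
  differentiated termwise. Bounded exit rates repair this: they bound every holding probability from
  below at the same linear rate, which controls all states outside a finite set. The error has to be
  uniform over test functions with values between \<open>0\<close> and \<open>1\<close>, because
  iterating the step replaces a test function by its average under the kernel. A one-sided estimate
  is enough, since mass is conserved and the complement of a test function is again one. Stability
  has two uses: it makes the weights summable, and for a single customer type it guarantees a
  compatible server, so that no denominator vanishes.\<close>

lemma has_sum_imp_nn_integral_count_space:
  fixes f :: "'a \<Rightarrow> real"
  assumes "(f has_sum a) A" and "\<And>x. x \<in> A \<Longrightarrow> f x \<ge> 0"
  shows "(\<integral>\<^sup>+x. f x \<partial>count_space A) = ennreal a"
proof -
  have "f summable_on A"
    using assms(1) by (auto simp: summable_on_def)
  then have abs: "Infinite_Sum.abs_summable_on f A"
    by (rule summable_on_iff_abs_summable_on_real[THEN iffD1])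
  then have "ennreal (infsetsum f A) = (\<integral>\<^sup>+x. f x \<partial>count_space A)"
    using assms(2) abs_summable_equivalent[THEN iffD1, OF abs]
    by (subst nn_integral_conv_infsetsum) auto
  moreover have "infsetsum f A = a"
    using assms(1) abs_summable_equivalent[THEN iffD1, OF abs]
    by (simp add: infsetsum_infsum infsumI)
  ultimately show ?thesis by simp
qed

lemma pmf_embed_pmf_has_sum:
  fixes f :: "'a \<Rightarrow> real"
  assumes "(f has_sum 1) S" and "\<And>x. x \<in> S \<Longrightarrow> f x \<ge> 0"
  shows "pmf (embed_pmf (\<lambda>x. if x \<in> S then f x else 0)) x = (if x \<in> S then f x else 0)"
proof (rule pmf_embed_pmf)
  have "((\<lambda>x. if x \<in> S then f x else 0) has_sum 1) UNIV"
    using assms(1) by (rule has_sum_cong_neutral[THEN iffD1, rotated -1]) auto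
  then show "(\<integral>\<^sup>+x. (if x \<in> S then f x else 0) \<partial>count_space UNIV) = 1"
    by (subst has_sum_imp_nn_integral_count_space) (auto simp: assms(2))
qed (simp add: assms(2))

lemma integrable_pmf_bounded:
  fixes f :: "'a \<Rightarrow> real"
  assumes "\<And>x. \<bar>f x\<bar> \<le> B"
  shows "integrable (measure_pmf p) f"
  using assms by (intro measure_pmf.integrable_const_bound[where B = B]) auto

lemma has_sum_pmf_expectation:
  fixes f :: "'a \<Rightarrow> real"
  assumes "\<And>x. \<bar>f x\<bar> \<le> B"
  shows "((\<lambda>x. pmf p x * f x) has_sum measure_pmf.expectation p f) UNIV"
proof -
  have "integrable (density (count_space UNIV) (pmf p)) f"
    using integrable_pmf_bounded[OF assms] by (simp add: measure_pmf_eq_density[symmetric])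
  then have "integrable (count_space UNIV) (\<lambda>x. pmf p x * f x)"
    by (subst (asm) integrable_density) auto
  then have abs: "Infinite_Sum.abs_summable_on (\<lambda>x. pmf p x * f x) UNIV"
    by (intro abs_summable_equivalent[THEN iffD2]) (simp add: abs_summable_on_def)
  then have "(\<lambda>x. pmf p x * f x) summable_on UNIV"
    by (rule abs_summable_summable)
  moreover have "measure_pmf.expectation p f = infsum (\<lambda>x. pmf p x * f x) UNIV"
    using abs_summable_equivalent[THEN iffD1, OF abs]
    by (simp add: pmf_expectation_eq_infsetsum infsetsum_infsum)
  ultimately show ?thesis by simp
qed

lemma has_sum_pmf: "(pmf p has_sum 1) UNIV"
  using has_sum_pmf_expectation[of "\<lambda>_. 1" 1 p] by simp

lemma pmf_expectation_bounds:
  fixes f :: "'a \<Rightarrow> real"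
  assumes "\<And>x. 0 \<le> f x" and "\<And>x. f x \<le> 1"
  shows "0 \<le> measure_pmf.expectation p f" and "measure_pmf.expectation p f \<le> 1"
  using assms measure_pmf.integral_le_const[of p f 1] integrable_pmf_bounded[of f 1 p]
  by (auto intro!: Bochner_Integration.integral_nonneg)

text \<open>Values between \<open>0\<close> and \<open>1\<close> let the identity pass through the
  nonnegative integral, where binding raises no question of integrability.\<close>

lemma expectation_bind_pmf:
  fixes f :: "'a \<Rightarrow> real"
  assumes "\<And>x. 0 \<le> f x" and "\<And>x. f x \<le> 1"
  shows "measure_pmf.expectation (bind_pmf p K) f
    = measure_pmf.expectation p (\<lambda>x. measure_pmf.expectation (K x) f)"
proof -
  note bound = pmf_expectation_bounds[of f, OF assms]
  have nn: "ennreal (measure_pmf.expectation q f) = (\<integral>\<^sup>+x. f x \<partial>q)" for q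
    using assms by (subst nn_integral_eq_integral) (auto intro!: integrable_pmf_bounded[of f 1])
  have "ennreal (measure_pmf.expectation (bind_pmf p K) f)
      = (\<integral>\<^sup>+x. ennreal (measure_pmf.expectation (K x) f) \<partial>p)"
    by (simp add: nn)
  also have "\<dots> = ennreal (measure_pmf.expectation p (\<lambda>x. measure_pmf.expectation (K x) f))"
    using bound by (subst nn_integral_eq_integral)
      (auto intro!: integrable_pmf_bounded[of "\<lambda>x. measure_pmf.expectation (K x) f" 1])
  finally show ?thesis
    using bound by (subst (asm) ennreal_inj) (auto intro!: Bochner_Integration.integral_nonneg)
qed

section \<open>Stationarity and the generator\<close>

locale transition_semigroup =
  fixes S :: "'x set" and P :: "real \<Rightarrow> 'x \<Rightarrow> 'x \<Rightarrow> real"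
  assumes transition: "transition_function S P"
begin

lemma nonneg: "t \<ge> 0 \<Longrightarrow> x \<in> S \<Longrightarrow> y \<in> S \<Longrightarrow> P t x y \<ge> 0"
  using transition by (simp add: transition_function_def)

lemma row_sum: "t \<ge> 0 \<Longrightarrow> x \<in> S \<Longrightarrow> (P t x has_sum 1) S"
  using transition by (simp add: transition_function_def)

lemma at_0: "x \<in> S \<Longrightarrow> y \<in> S \<Longrightarrow> P 0 x y = (if x = y then 1 else 0)"
  using transition by (simp add: transition_function_def)

lemma Chapman_Kolmogorov:
  assumes "s \<ge> 0" "t \<ge> 0" "x \<in> S" "y \<in> S"
  shows "((\<lambda>z. P s x z * P t z y) has_sum P (s + t) x y) S"
  using transition assms by (simp add: transition_function_def)

lemma prob_via:
  assumes "s \<ge> 0" "t \<ge> 0" "x \<in> S" "y \<in> S" "z \<in> S"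
  shows "P s x z * P t z y \<le> P (s + t) x y"
proof -
  have "((\<lambda>z. P s x z * P t z y) has_sum (P s x z * P t z y)) {z}"
    by (rule has_sum_finiteI) auto
  then show ?thesis
    using Chapman_Kolmogorov[OF assms(1-4)]
    by (rule has_sum_mono_neutral) (use assms nonneg in auto)
qed

section \<open>Holding probabilities and the diagonal of the generator\<close>

lemma stay_power:
  assumes "t \<ge> 0" "x \<in> S"
  shows "P t x x ^ n \<le> P (n * t) x x"
proof (induction n)
  case 0
  then show ?case using assms by (simp add: at_0)
next
  case (Suc n)
  have "P t x x * P t x x ^ n \<le> P t x x * P (n * t) x x"
    using Suc assms nonneg by (intro mult_left_mono) auto
  also have "\<dots> \<le> P (t + n * t) x x"
    using assms by (intro prob_via) auto
  finally show ?case by (simp add: algebra_simps)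
qed

text \<open>Being at \<open>x\<close> at all multiples of \<open>h / n\<close> is one way to be
  there at time \<open>h\<close>. With \<open>stay_power\<close>, Bernoulli's inequality turns the
  derivative at \<open>0\<close> into a bound for every \<open>h\<close>.\<close>

lemma stay_prob:
  assumes x: "x \<in> S" and h: "h \<ge> 0"
    and deriv: "((\<lambda>t. P t x x) has_real_derivative q) (at 0 within {0..})"
  shows "1 + q * h \<le> P h x x"
proof (cases "h = 0")
  case True
  then show ?thesis using x by (simp add: at_0)
next
  case False
  then have h: "h > 0" using h by simp
  show ?thesis
  proof (rule field_le_epsilon)
    fix e :: real assume e: "e > 0"
    \<comment> \<open>The slope is lowered by \<open>e / h\<close> so that the bound at time
      \<open>h\<close> drops by exactly \<open>e\<close>.\<close>
    define r where "r = q - e / h"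
    have lim: "((\<lambda>t. (P t x x - 1) / t) \<longlongrightarrow> q) (at 0 within {0..})"
      using deriv x by (simp add: has_field_derivative_iff at_0)
    have "r < q" using e h by (simp add: r_def)
    with lim have "eventually (\<lambda>t. (P t x x - 1) / t > r) (at 0 within {0..})"
      by (rule order_tendstoD)
    then obtain d where d: "d > 0" "\<And>t. t > 0 \<Longrightarrow> t < d \<Longrightarrow> (P t x x - 1) / t > r"
      unfolding eventually_at by (auto simp: dist_real_def)
    \<comment> \<open>The bound \<open>h / d\<close> makes the steps shorter than \<open>d\<close>;
      the bound \<open>\<bar>r\<bar> * h\<close> keeps \<open>r * t\<close> above \<open>-1\<close>,
      as Bernoulli's inequality requires.\<close>
    obtain n :: nat where n: "real n > max (h / d) (\<bar>r\<bar> * h)"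
      using reals_Archimedean2 by blast
    have n0: "real n > 0" using n h d(1)
      by (metis abs_ge_zero less_eq_real_def max.strict_boundedE mult_nonneg_nonneg order_le_less_trans)
    define t where "t = h / n"
    have t: "t > 0" "t < d" "\<bar>r\<bar> * t < 1" "n * t = h"
      using n n0 h d(1) by (auto simp: t_def field_simps)
    have "\<bar>r * t\<bar> < 1"
      using t(1,3) by (simp add: abs_mult)
    then have rt: "-1 \<le> r * t"
      by linarith
    have "1 + r * h = 1 + real n * (r * t)"
      unfolding t(4)[symmetric] by simp
    also have "\<dots> \<le> (1 + r * t) ^ n"
      using rt by (rule Bernoulli_inequality)
    also have "\<dots> \<le> P t x x ^ n"
    proof (rule power_mono)
      show "1 + r * t \<le> P t x x" using d(2)[OF t(1,2)] t(1) by (simp add: field_simps)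
      show "0 \<le> 1 + r * t" using rt by simp
    qed
    also have "\<dots> \<le> P h x x" using stay_power[of t x n] t x by simp
    finally show "1 + q * h \<le> P h x x + e" using h by (simp add: r_def left_diff_distrib)
  qed
qed

text \<open>Casting the rows of \<open>P\<close> as pmfs turns the Chapman-Kolmogorov equations into
  a composition law for \<open>bind_pmf\<close>. Point masses off \<open>S\<close> make the map
  total.\<close>

definition kernel :: "real \<Rightarrow> 'x \<Rightarrow> 'x pmf" where
  "kernel t x = (if x \<in> S then embed_pmf (\<lambda>y. if y \<in> S then P t x y else 0) else return_pmf x)"

lemma pmf_kernel:
  "t \<ge> 0 \<Longrightarrow> x \<in> S \<Longrightarrow> pmf (kernel t x) y = (if y \<in> S then P t x y else 0)"
  unfolding kernel_def by (simp add: pmf_embed_pmf_has_sum row_sum nonneg)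

lemma set_kernel: "t \<ge> 0 \<Longrightarrow> x \<in> S \<Longrightarrow> set_pmf (kernel t x) \<subseteq> S"
  by (auto simp: set_pmf_eq pmf_kernel split: if_splits)

lemma pmf_bind_kernel:
  assumes "t \<ge> 0" "set_pmf p \<subseteq> S"
  shows "y \<in> S \<Longrightarrow> ((\<lambda>x. pmf p x * P t x y) has_sum pmf (bind_pmf p (kernel t)) y) S"
    and "y \<notin> S \<Longrightarrow> pmf (bind_pmf p (kernel t)) y = 0"
proof -
  have "((\<lambda>x. pmf p x * pmf (kernel t x) y) has_sum pmf (bind_pmf p (kernel t)) y) UNIV"
    unfolding pmf_bind by (rule has_sum_pmf_expectation[of _ 1]) (auto simp: pmf_le_1)
  then have "((\<lambda>x. pmf p x * P t x y) has_sum pmf (bind_pmf p (kernel t)) y) S" if "y \<in> S"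
    by (rule has_sum_cong_neutral[THEN iffD1, rotated -1])
      (use assms that in \<open>auto simp: pmf_kernel pmf_eq_0_set_pmf\<close>)
  then show "((\<lambda>x. pmf p x * P t x y) has_sum pmf (bind_pmf p (kernel t)) y) S" if "y \<in> S"
    using that by blast
  show "pmf (bind_pmf p (kernel t)) y = 0" if "y \<notin> S"
    using set_kernel[OF assms(1)] assms(2) that by (auto simp: pmf_eq_0_set_pmf)
qed

lemma stationary_iff_kernel:
  "stationary_distribution S P p \<longleftrightarrow>
     set_pmf p \<subseteq> S \<and> (\<forall>t\<ge>0. bind_pmf p (kernel t) = p)"
proof (intro iffI conjI allI impI)
  assume p: "stationary_distribution S P p"
  then show "set_pmf p \<subseteq> S" by (simp add: stationary_distribution_def)
  fix t :: real assume t: "t \<ge> 0"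
  show "bind_pmf p (kernel t) = p"
  proof (rule pmf_eqI)
    fix y
    show "pmf (bind_pmf p (kernel t)) y = pmf p y"
    proof (cases "y \<in> S")
      case True
      then have "((\<lambda>x. pmf p x * P t x y) has_sum pmf p y) S"
        using p t by (auto simp: stationary_distribution_def)
      then show ?thesis
        using pmf_bind_kernel(1)[OF t \<open>set_pmf p \<subseteq> S\<close> True] has_sum_unique by blast
    next
      case False
      then show ?thesis
        using pmf_bind_kernel(2)[OF t \<open>set_pmf p \<subseteq> S\<close> False] \<open>set_pmf p \<subseteq> S\<close>
        by (metis pmf_eq_0_set_pmf subsetD)
    qed
  qed
next
  assume "set_pmf p \<subseteq> S \<and> (\<forall>t\<ge>0. bind_pmf p (kernel t) = p)"
  then show "stationary_distribution S P p"
    using pmf_bind_kernel(1)[of _ p] by (fastforce simp: stationary_distribution_def)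
qed

lemma bind_kernel_kernel:
  assumes "s \<ge> 0" "t \<ge> 0" "set_pmf p \<subseteq> S"
  shows "bind_pmf (bind_pmf p (kernel s)) (kernel t) = bind_pmf p (kernel (s + t))"
proof -
  have "bind_pmf (kernel s x) (kernel t) = kernel (s + t) x" if x: "x \<in> set_pmf p" for x
  proof (rule pmf_eqI)
    fix y
    have x: "x \<in> S" using x assms by auto
    have p: "set_pmf (kernel s x) \<subseteq> S" using set_kernel assms x by auto
    show "pmf (bind_pmf (kernel s x) (kernel t)) y = pmf (kernel (s + t) x) y"
    proof (cases "y \<in> S")
      case True
      have "((\<lambda>z. P s x z * P t z y) has_sum pmf (bind_pmf (kernel s x) (kernel t)) y) S"
        by (rule has_sum_cong[THEN iffD1, OF _ pmf_bind_kernel(1)[OF assms(2) p True]])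
          (simp add: pmf_kernel assms x)
      then have "pmf (bind_pmf (kernel s x) (kernel t)) y = P (s + t) x y"
        using Chapman_Kolmogorov[OF assms(1,2) x True] has_sum_unique by blast
      then show ?thesis using x True assms by (simp add: pmf_kernel)
    next
      case False
      then show ?thesis
        using pmf_bind_kernel(2)[OF assms(2) p False] x assms by (simp add: pmf_kernel)
    qed
  qed
  then show ?thesis
    unfolding bind_assoc_pmf by (intro bind_pmf_cong) auto
qed

section \<open>Stationarity from the balance inequalities\<close>

text \<open>
  The one-step loss of mass is \<open>o(h)\<close> uniformly over test functions: on a finite set carrying most
  of \<open>p\<close> the derivative hypothesis applies, and elsewhere \<open>p x - (p P\<^sub>h) x \<le> L h p x\<close>.
\<close>

lemma expectation_loss_small:
  assumes p: "set_pmf p \<subseteq> S"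
    and stay: "\<And>x h. x \<in> S \<Longrightarrow> h \<ge> 0 \<Longrightarrow> 1 - L * h \<le> P h x x"
    and L: "L \<ge> 0"
    and loss: "\<And>y e. y \<in> S \<Longrightarrow> e > 0 \<Longrightarrow>
       \<exists>d>0. \<forall>h. 0 < h \<longrightarrow> h < d \<longrightarrow> pmf p y - e * h \<le> pmf (bind_pmf p (kernel h)) y"
    and e: "e > 0"
  shows "\<exists>d>0. \<forall>h f. 0 < h \<longrightarrow> h < d \<longrightarrow> (\<forall>x. 0 \<le> f x \<and> f x \<le> 1) \<longrightarrow>
    measure_pmf.expectation p f \<le> measure_pmf.expectation (bind_pmf p (kernel h)) f + e * h"
proof -
  \<comment> \<open>Outside \<open>A\<close> mass is lost at rate at most \<open>L\<close>, so the
    tail accounts for at most \<open>e / 2\<close>; \<open>L + 1\<close> avoids a division by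
    zero.\<close>
  obtain A where A: "finite A" "dist (sum (pmf p) A) 1 \<le> e / (2 * (L + 1))"
    using has_sum_finite_approximation[OF has_sum_pmf, of "e / (2 * (L + 1))" p] e L by auto
  \<comment> \<open>Each state of \<open>A\<close> may lose \<open>\<delta> * h\<close>, together at
    most the other half of \<open>e * h\<close>; the added \<open>1\<close> covers an empty
    \<open>A\<close>.\<close>
  define \<delta> where "\<delta> = e / (2 * (card A + 1))"
  have \<delta>: "\<delta> > 0" using e by (simp add: \<delta>_def)
  have "\<exists>d>0. \<forall>h. 0 < h \<longrightarrow> h < d \<longrightarrow> pmf p y - \<delta> * h \<le> pmf (bind_pmf p (kernel h)) y" for y
  proof (cases "y \<in> S")
    case True
    then show ?thesis using loss \<delta> by blast
  next
    case False
    then have "pmf p y = 0" using p by (metis pmf_eq_0_set_pmf subsetD)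
    then have "pmf p y - \<delta> * h \<le> pmf (bind_pmf p (kernel h)) y" if "h > 0" for h
      using \<delta> that pmf_nonneg[of "bind_pmf p (kernel h)" y] mult_pos_pos[of \<delta> h] by linarith
    then show ?thesis by (intro exI[of _ 1]) auto
  qed
  then obtain d where d: "\<And>y. d y > 0"
    "\<And>y h. 0 < h \<Longrightarrow> h < d y \<Longrightarrow> pmf p y - \<delta> * h \<le> pmf (bind_pmf p (kernel h)) y"
    by metis
  define D where "D = Min (insert 1 (d ` A))"
  have D: "D > 0" "\<And>y. y \<in> A \<Longrightarrow> D \<le> d y"
    using A(1) d(1) by (auto simp: D_def)
  have tail: "((\<lambda>y. if y \<in> A then 0 else pmf p y) has_sum (1 - sum (pmf p) A)) UNIV"
  proof -
    have "(pmf p has_sum (1 - sum (pmf p) A)) (UNIV - A)"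
      using has_sum_Diff[OF has_sum_pmf has_sum_finite[OF A(1)]] by simp
    then show ?thesis
      by (rule has_sum_cong_neutral[THEN iffD1, rotated -1]) auto
  qed
  have "measure_pmf.expectation p f \<le> measure_pmf.expectation (bind_pmf p (kernel h)) f + e * h"
    if h: "0 < h" "h < D" and f: "\<And>x. 0 \<le> f x" "\<And>x. f x \<le> 1" for h and f :: "'x \<Rightarrow> real"
  proof -
    let ?u = "bind_pmf p (kernel h)"
    \<comment> \<open>\<open>w y * h\<close> bounds the mass lost at \<open>y\<close>: by the choice
      of \<open>d\<close> on \<open>A\<close>, by the holding probability elsewhere.\<close>
    define w where "w y = (if y \<in> A then \<delta> else 0) + L * (if y \<in> A then 0 else pmf p y)" for y
    have "((\<lambda>y. if y \<in> A then \<delta> else 0) has_sum (\<Sum>y\<in>A. \<delta>)) UNIV"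
      by (rule has_sum_cong_neutral[THEN iffD1, OF _ _ _ has_sum_finite[OF A(1)]]) auto
    then have w_sum: "(w has_sum ((\<Sum>y\<in>A. \<delta>) + L * (1 - sum (pmf p) A))) UNIV"
      unfolding w_def by (intro has_sum_add has_sum_cmult_right tail)
    have w_le: "pmf p y \<le> pmf ?u y + w y * h" for y
    proof (cases "y \<in> A")
      case True
      then show ?thesis using d(2)[of h y] D(2)[of y] h by (simp add: w_def algebra_simps)
    next
      case False
      show ?thesis
      proof (cases "y \<in> S")
        case True
        have "pmf p y * (1 - L * h) \<le> pmf p y * P h y y"
          using stay[of y h] True h by (intro mult_left_mono) auto
        also have "\<dots> \<le> pmf ?u y"
        proof (rule has_sum_mono_neutral)
          show "((\<lambda>x. pmf p x * P h x y) has_sum (pmf p y * P h y y)) {y}"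
            by (rule has_sum_finiteI) auto
          show "((\<lambda>x. pmf p x * P h x y) has_sum pmf ?u y) S"
            using h p True by (intro pmf_bind_kernel) auto
        qed (use True h nonneg in auto)
        finally show ?thesis using False by (simp add: w_def algebra_simps)
      next
        case False
        then have "pmf p y = 0" using p by (metis pmf_eq_0_set_pmf subsetD)
        then show ?thesis using \<delta> h by (simp add: w_def)
      qed
    qed
    have w0: "w y \<ge> 0" for y using \<delta> L by (simp add: w_def)
    have fb: "\<bar>f x\<bar> \<le> 1" for x using f by simp
    have "measure_pmf.expectation p f
        \<le> measure_pmf.expectation ?u f + ((\<Sum>y\<in>A. \<delta>) + L * (1 - sum (pmf p) A)) * h"
    proof (rule has_sum_mono)
      show "((\<lambda>y. pmf p y * f y) has_sum measure_pmf.expectation p f) UNIV"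
        using fb by (rule has_sum_pmf_expectation)
      show "((\<lambda>y. pmf ?u y * f y + w y * h) has_sum
         (measure_pmf.expectation ?u f + ((\<Sum>y\<in>A. \<delta>) + L * (1 - sum (pmf p) A)) * h)) UNIV"
        using fb by (intro has_sum_add has_sum_pmf_expectation has_sum_cmult_left w_sum)
      show "pmf p y * f y \<le> pmf ?u y * f y + w y * h" for y
      proof -
        have "pmf p y * f y \<le> (pmf ?u y + w y * h) * f y"
          using w_le f by (intro mult_right_mono)
        also have "\<dots> \<le> pmf ?u y * f y + w y * h * 1"
          using f w0 h by (simp add: distrib_right mult_left_le)
        finally show ?thesis by simp
      qed
    qed
    moreover have "(\<Sum>y\<in>A. \<delta>) \<le> e / 2"
      using e by (simp add: \<delta>_def field_simps)
    moreover have "L * (1 - sum (pmf p) A) \<le> e / 2"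
    proof -
      have "1 - sum (pmf p) A \<le> e / (2 * (L + 1))"
        using A(2) by (simp add: dist_real_def)
      then have "L * (1 - sum (pmf p) A) \<le> L * (e / (2 * (L + 1)))"
        using L by (rule mult_left_mono)
      also have "\<dots> \<le> e / 2" using e L by (simp add: field_simps)
      finally show ?thesis .
    qed
    ultimately show ?thesis
      using h mult_right_mono[of "(\<Sum>y\<in>A. \<delta>) + L * (1 - sum (pmf p) A)" e h] by linarith
  qed
  then show ?thesis using D(1) by blast
qed

lemma bind_kernel_0:
  assumes p: "set_pmf p \<subseteq> S"
  shows "bind_pmf p (kernel 0) = p"
proof (rule pmf_eqI)
  fix y
  show "pmf (bind_pmf p (kernel 0)) y = pmf p y"
  proof (cases "y \<in> S")
    case True
    have "((\<lambda>x. pmf p x * P 0 x y) has_sum pmf p y) S"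
    proof (rule has_sum_cong_neutral[THEN iffD1])
      show "((\<lambda>x. pmf p x) has_sum pmf p y) {y}"
        by (rule has_sum_finiteI) auto
    qed (use True in \<open>auto simp: at_0\<close>)
    then show ?thesis
      using pmf_bind_kernel(1)[of 0 p y] p True has_sum_unique by fastforce
  next
    case False
    then show ?thesis
      using pmf_bind_kernel(2)[of 0 p y] p by (metis order_refl pmf_eq_0_set_pmf subsetD)
  qed
qed

text \<open>The induction replaces \<open>f\<close> by \<open>?g\<close>, its average under one
  step, which again lies between \<open>0\<close> and \<open>1\<close>. This is why
  \<open>step\<close> is assumed for all test functions; the losses of the single steps then add
  up.\<close>

lemma expectation_loss_iterate:
  assumes p: "set_pmf p \<subseteq> S" and h: "h > 0"
    and step: "\<And>f. (\<forall>x. 0 \<le> f x \<and> f x \<le> 1) \<Longrightarrow>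
      measure_pmf.expectation p f \<le> measure_pmf.expectation (bind_pmf p (kernel h)) f + c"
    and f: "\<And>x. 0 \<le> f x" "\<And>x. f x \<le> 1"
  shows "measure_pmf.expectation p f
    \<le> measure_pmf.expectation (bind_pmf p (kernel (real n * h))) f + real n * c"
  using f
proof (induction n arbitrary: f)
  case 0
  show ?case using bind_kernel_0[OF p] by simp
next
  case (Suc n)
  let ?g = "\<lambda>x. measure_pmf.expectation (kernel h x) f"
  have g: "0 \<le> ?g x" "?g x \<le> 1" for x
    using pmf_expectation_bounds Suc.prems by auto
  have "measure_pmf.expectation p f \<le> measure_pmf.expectation (bind_pmf p (kernel h)) f + c"
    using Suc.prems by (intro step) auto
  also have "measure_pmf.expectation (bind_pmf p (kernel h)) f = measure_pmf.expectation p ?g"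
    using Suc.prems by (rule expectation_bind_pmf)
  also have "\<dots> \<le> measure_pmf.expectation (bind_pmf p (kernel (n * h))) ?g + n * c"
    using g by (rule Suc.IH)
  also have "measure_pmf.expectation (bind_pmf p (kernel (n * h))) ?g
      = measure_pmf.expectation (bind_pmf (bind_pmf p (kernel (n * h))) (kernel h)) f"
    using Suc.prems by (rule expectation_bind_pmf[symmetric])
  also have "\<dots> = measure_pmf.expectation (bind_pmf p (kernel (Suc n * h))) f"
    using bind_kernel_kernel[of "n * h" h p] p h by (simp add: algebra_simps)
  finally show ?case by (simp add: algebra_simps)
qed

text \<open>The balance condition is stated for finite sets because a finite sum can be
  differentiated termwise, while states outside \<open>F\<close> only add mass. A nonnegative
  derivative means that no state loses more than \<open>o(h)\<close>; as the total mass is fixed,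
  nothing can be gained either.\<close>

theorem stationary_if_balance:
  assumes p: "set_pmf p \<subseteq> S"
    and gen: "has_generator S P Q"
    and bounded: "\<And>x. x \<in> S \<Longrightarrow> - L \<le> Q x x"
    and balance: "\<And>y. y \<in> S \<Longrightarrow>
       \<exists>F. finite F \<and> F \<subseteq> S \<and> y \<in> F \<and> (\<Sum>x\<in>F. pmf p x * Q x y) \<ge> 0"
  shows "stationary_distribution S P p"
proof -
  have deriv: "((\<lambda>t. P t x y) has_real_derivative Q x y) (at 0 within {0..})"
    if "x \<in> S" "y \<in> S" for x y
    using gen that by (simp add: has_generator_def)
  \<comment> \<open>The tail estimate asks for a nonnegative rate, and the sign of \<open>L\<close>
    is not given.\<close>
  define M where "M = max L 0"
  have stay: "1 - M * h \<le> P h x x" if "x \<in> S" "h \<ge> 0" for x h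
  proof -
    have "- M \<le> Q x x" using bounded[OF that(1)] by (simp add: M_def)
    then have "- M * h \<le> Q x x * h" using that(2) by (rule mult_right_mono)
    then show ?thesis using stay_prob[OF that deriv[OF that(1,1)]] by simp
  qed
  have loss: "\<exists>d>0. \<forall>h. 0 < h \<longrightarrow> h < d \<longrightarrow> pmf p y - e * h \<le> pmf (bind_pmf p (kernel h)) y"
    if y: "y \<in> S" and e: "e > 0" for y e
  proof -
    obtain F where F: "finite F" "F \<subseteq> S" "y \<in> F" "(\<Sum>x\<in>F. pmf p x * Q x y) \<ge> 0"
      using balance[OF y] by blast
    define g where "g t = (\<Sum>x\<in>F. pmf p x * P t x y)" for t
    have g0: "g 0 = pmf p y"
    proof -
      have "g 0 = (\<Sum>x\<in>F. if x = y then pmf p y else 0)"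
        unfolding g_def using F y by (intro sum.cong) (auto simp: at_0)
      then show ?thesis using F by simp
    qed
    have "(g has_real_derivative (\<Sum>x\<in>F. pmf p x * Q x y)) (at 0 within {0..})"
      unfolding g_def using F y by (intro DERIV_sum DERIV_cmult deriv) auto
    then have "((\<lambda>t. (g t - g 0) / t) \<longlongrightarrow> (\<Sum>x\<in>F. pmf p x * Q x y)) (at 0 within {0..})"
      by (simp add: has_field_derivative_iff)
    moreover have "- e < (\<Sum>x\<in>F. pmf p x * Q x y)" using F e by simp
    ultimately have "eventually (\<lambda>t. - e < (g t - g 0) / t) (at 0 within {0..})"
      by (rule order_tendstoD)
    then obtain d where d: "d > 0" "\<And>t. t > 0 \<Longrightarrow> t < d \<Longrightarrow> - e < (g t - g 0) / t"
      unfolding eventually_at by (auto simp: dist_real_def)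
    have "pmf p y - e * h \<le> pmf (bind_pmf p (kernel h)) y" if h: "0 < h" "h < d" for h
    proof -
      have "pmf p y - e * h \<le> g h"
        using d(2)[OF h] h(1) by (simp add: g0 field_simps)
      also have "\<dots> \<le> pmf (bind_pmf p (kernel h)) y"
      proof (rule has_sum_mono_neutral)
        show "((\<lambda>x. pmf p x * P h x y) has_sum g h) F"
          using F by (intro has_sum_finiteI) (auto simp: g_def)
        show "((\<lambda>x. pmf p x * P h x y) has_sum pmf (bind_pmf p (kernel h)) y) S"
          using h p y by (intro pmf_bind_kernel) auto
      qed (use F h y nonneg in auto)
      finally show ?thesis .
    qed
    then show ?thesis using d(1) by blast
  qed
  have main: "measure_pmf.expectation p f \<le> measure_pmf.expectation (bind_pmf p (kernel t)) f"
    if t: "t \<ge> 0" and f: "\<And>x. 0 \<le> f x" "\<And>x. f x \<le> 1" for t and f :: "'x \<Rightarrow> real"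
  proof (rule field_le_epsilon)
    fix e :: real assume e: "e > 0"
    \<comment> \<open>The \<open>n\<close> steps of length \<open>t / n\<close> cost
      \<open>c * t\<close> in total; \<open>t + 1\<close> keeps the quotient meaningful at
      \<open>t = 0\<close>.\<close>
    define c where "c = e / (t + 1)"
    have c: "c > 0" using e t by (simp add: c_def)
    have "M \<ge> 0" by (simp add: M_def)
    from expectation_loss_small[OF p stay this loss c]
    obtain d where d: "d > 0"
      "\<And>h f. 0 < h \<Longrightarrow> h < d \<Longrightarrow> (\<forall>x. 0 \<le> f x \<and> f x \<le> 1) \<Longrightarrow>
        measure_pmf.expectation p f \<le> measure_pmf.expectation (bind_pmf p (kernel h)) f + c * h"
      by blast
    show "measure_pmf.expectation p f \<le> measure_pmf.expectation (bind_pmf p (kernel t)) f + e"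
    proof (cases "t = 0")
      case True
      then show ?thesis
        using e by (simp add: bind_kernel_0[OF p])
    next
      case False
      then have t: "t > 0" using t by simp
      obtain n :: nat where n: "real n > t / d"
        using reals_Archimedean2 by blast
      have n0: "real n > 0" using n d(1) t by (meson divide_pos_pos order_less_trans)
      have h: "0 < t / n" "t / n < d" "n * (t / n) = t"
        using n n0 d(1) t by (auto simp: field_simps)
      have "measure_pmf.expectation p f
          \<le> measure_pmf.expectation (bind_pmf p (kernel (real n * (t / n)))) f
            + real n * (c * (t / n))"
        using p h(1) d(2)[OF h(1,2)] f by (rule expectation_loss_iterate)
      then have "measure_pmf.expectation p f
          \<le> measure_pmf.expectation (bind_pmf p (kernel t)) f + n * (c * (t / n))"
        unfolding h(3) .
      also have "real n * (c * (t / n)) = c * t" using n0 by simp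
      also have "\<dots> \<le> e" using e t by (simp add: c_def field_simps)
      finally show ?thesis by simp
    qed
  qed
  have "bind_pmf p (kernel t) = p" if t: "t \<ge> 0" for t
  proof (rule pmf_eqI)
    fix y
    let ?f = "indicator {y} :: 'x \<Rightarrow> real"
    \<comment> \<open>Testing with the complement of the indicator yields the reverse of the
      inequality that the indicator itself yields.\<close>
    have "measure_pmf.expectation q (\<lambda>x. 1 - ?f x) = 1 - pmf q y" for q
      by (subst Bochner_Integration.integral_diff)
        (auto simp: measure_pmf_single intro!: integrable_pmf_bounded[of _ 1])
    then have "1 - pmf p y \<le> 1 - pmf (bind_pmf p (kernel t)) y"
      using main[OF t, of "\<lambda>x. 1 - ?f x"] by (simp add: indicator_def)
    moreover have "pmf p y \<le> pmf (bind_pmf p (kernel t)) y"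
      using main[OF t, of ?f] by (simp add: measure_pmf_single)
    ultimately show "pmf (bind_pmf p (kernel t)) y = pmf p y" by simp
  qed
  then show ?thesis using p by (simp add: stationary_iff_kernel)
qed

text \<open>Let \<open>B\<close> be the set where \<open>p\<close> exceeds \<open>q\<close>.
  Invariance of \<open>p - q\<close> forbids mass to leave \<open>B\<close>, and forbids it to enter
  \<open>B\<close> from a state where \<open>q\<close> exceeds \<open>p\<close>. A state
  \<open>z\<close> reachable from both kinds would have to lie in \<open>B\<close> and outside
  it.\<close>

theorem stationary_unique:
  assumes z: "z \<in> S" and reach: "\<And>x. x \<in> S \<Longrightarrow> \<exists>t\<ge>0. P t x z > 0"
    and p: "stationary_distribution S P p" and q: "stationary_distribution S P q"
  shows "p = q"
proof (rule ccontr)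
  assume "p \<noteq> q"
  obtain a b where a: "pmf q a < pmf p a" and b: "pmf p b < pmf q b"
    using pmf_neq_exists_less \<open>p \<noteq> q\<close> by metis
  have pS: "set_pmf p \<subseteq> S" and qS: "set_pmf q \<subseteq> S"
    using p q by (auto simp: stationary_iff_kernel)
  have aS: "a \<in> S" using a pS by (metis pmf_eq_0_set_pmf pmf_nonneg not_le subsetD)
  have bS: "b \<in> S" using b qS by (metis pmf_eq_0_set_pmf pmf_nonneg not_le subsetD)
  define B where "B = {y. pmf q y < pmf p y}"
  let ?f = "indicator B :: 'x \<Rightarrow> real"
  \<comment> \<open>The second factor is nonnegative on \<open>B\<close> and nonpositive off
    \<open>B\<close>, like \<open>p - q\<close>. Stationarity makes these nonnegative products sum
    to zero, so each of them vanishes.\<close>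
  have flow: "(pmf p x - pmf q x) * (?f x - measure_pmf.prob (kernel t x) B) = 0"
    if t: "t \<ge> 0" for t x
  proof -
    let ?g = "\<lambda>x. ?f x - measure_pmf.prob (kernel t x) B"
    have gb: "\<bar>?g x\<bar> \<le> 1" for x
      by (auto simp: indicator_def measure_pmf.prob_le_1)
    have zero: "measure_pmf.expectation r ?g = 0" if "bind_pmf r (kernel t) = r" for r
    proof -
      have "measure_pmf.expectation r ?g = measure_pmf.expectation r ?f
          - measure_pmf.expectation r (\<lambda>x. measure_pmf.expectation (kernel t x) ?f)"
        by (subst Bochner_Integration.integral_diff)
          (auto intro!: integrable_pmf_bounded[of _ 1] simp: measure_pmf.prob_le_1)
      also have "measure_pmf.expectation r (\<lambda>x. measure_pmf.expectation (kernel t x) ?f)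
          = measure_pmf.expectation r ?f"
        by (subst expectation_bind_pmf[symmetric]) (auto simp: that)
      finally show ?thesis by simp
    qed
    have "((\<lambda>x. pmf r x * ?g x) has_sum 0) UNIV" if "stationary_distribution S P r" for r
    proof -
      have "measure_pmf.expectation r ?g = 0"
        using that t by (intro zero) (simp add: stationary_iff_kernel)
      then show ?thesis
        using has_sum_pmf_expectation[of ?g 1 r] gb by metis
    qed
    then have "((\<lambda>x. pmf p x * ?g x) has_sum 0) UNIV" "((\<lambda>x. pmf q x * ?g x) has_sum 0) UNIV"
      using p q by blast+
    from has_sum_add[OF this(1) has_sum_cmult_right[OF this(2), of "- 1"]] have "((\<lambda>x. (pmf p x - pmf q x) * ?g x) has_sum 0) UNIV"
      by (simp add: left_diff_distrib)
    then show ?thesis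
    proof (rule nonneg_has_sum_le_0D)
      show "0 \<le> (pmf p x - pmf q x) * ?g x" for x
        by (cases "x \<in> B") (auto simp: B_def measure_pmf.prob_le_1 mult_nonneg_nonpos2
          intro!: mult_nonneg_nonneg mult_nonpos_nonpos)
    qed auto
  qed
  obtain s where s: "s \<ge> 0" "P s a z > 0" using reach aS by blast
  obtain t where t: "t \<ge> 0" "P t b z > 0" using reach bS by blast
  have "measure_pmf.prob (kernel s a) B = 1"
    using flow[OF s(1), of a] a by (simp add: B_def)
  then have "set_pmf (kernel s a) \<subseteq> B"
    by (simp add: measure_pmf.prob_eq_1 AE_measure_pmf_iff subset_iff)
  then have "z \<in> B"
    using s z aS by (auto simp: set_pmf_eq pmf_kernel)
  moreover have "measure_pmf.prob (kernel t b) B = 0"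
    using flow[OF t(1), of b] b by (simp add: B_def)
  then have "set_pmf (kernel t b) \<inter> B = {}"
    by (simp add: measure_pmf_zero_iff)
  moreover have "z \<in> set_pmf (kernel t b)"
    using t z bS by (simp add: set_pmf_eq pmf_kernel)
  ultimately show False by blast
qed

text \<open>As \<open>P 0 x y = 0\<close>, a positive derivative makes \<open>P h x y\<close>
  positive for small \<open>h > 0\<close>; Chapman-Kolmogorov appends the way from \<open>y\<close>
  to \<open>z\<close>.\<close>

lemma reach_step:
  assumes gen: "has_generator S P Q"
    and "x \<in> S" "y \<in> S" "z \<in> S" "x \<noteq> y" and rate: "Q x y > 0"
    and reach: "\<exists>t\<ge>0. P t y z > 0"
  shows "\<exists>t\<ge>0. P t x z > 0"
proof -
  obtain t where t: "t \<ge> 0" "P t y z > 0" using reach by blast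
  have "((\<lambda>t. P t x y / t) \<longlongrightarrow> Q x y) (at 0 within {0..})"
    using gen[unfolded has_generator_def, rule_format, OF \<open>x \<in> S\<close> \<open>y \<in> S\<close>] assms
    by (simp add: has_field_derivative_iff at_0)
  then have "eventually (\<lambda>t. P t x y / t > 0) (at 0 within {0..})"
    using rate by (rule order_tendstoD)
  then obtain d where d: "d > 0" "\<And>t. t > 0 \<Longrightarrow> t < d \<Longrightarrow> P t x y / t > 0"
    unfolding eventually_at by (auto simp: dist_real_def)
  define h where "h = d / 2"
  have h: "h > 0" "P h x y > 0"
    using d(1) d(2)[of h] by (auto simp: h_def zero_less_divide_iff)
  have "0 < P h x y * P t y z" using h t by simp
  also have "\<dots> \<le> P (h + t) x z" using assms h t by (intro prob_via) auto
  finally show ?thesis using h t by (intro exI[of _ "h + t"]) auto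
qed

end

section \<open>Product-form weights of words\<close>

text \<open>Letters and partners are abstract so that both factors of the product form are
  instances: customers with \<open>E\<close>, idle servers with \<open>E\<inverse>\<close> and the
  rates exchanged.\<close>

definition word_weight ::
  "('b \<times> 'a) set \<Rightarrow> ('a \<Rightarrow> real) \<Rightarrow> ('b \<Rightarrow> real) \<Rightarrow> 'a list \<Rightarrow> real" where
  "word_weight E \<alpha> \<beta> l =
     (\<Prod>i<length l. \<alpha> (l ! i) / (\<Sum>b\<in>compatible_servers E (set (take (Suc i) l)). \<beta> b))"

lemma word_weight_Nil [simp]: "word_weight E \<alpha> \<beta> [] = 1"
  by (simp add: word_weight_def)

lemma word_weight_snoc:
  "word_weight E \<alpha> \<beta> (l @ [a]) =
     word_weight E \<alpha> \<beta> l * (\<alpha> a / (\<Sum>b\<in>compatible_servers E (insert a (set l)). \<beta> b))"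
proof -
  have "(\<Prod>i<length l. \<alpha> ((l @ [a]) ! i) /
          (\<Sum>b\<in>compatible_servers E (set (take (Suc i) (l @ [a]))). \<beta> b)) = word_weight E \<alpha> \<beta> l"
    unfolding word_weight_def by (intro prod.cong) (auto simp: nth_append)
  then show ?thesis
    unfolding word_weight_def[of E \<alpha> \<beta> "l @ [a]"] by (simp add: insert_commute)
qed

text \<open>These are the predecessors of \<open>l\<close> under a removal by \<open>b\<close>. The
  letter \<open>d\<close> is recorded because the flow balances for each letter separately, and
  because in a queue state some letters are excluded.\<close>

definition first_match_words :: "('b \<times> 'a) set \<Rightarrow> 'b \<Rightarrow> 'a \<Rightarrow> 'a list \<Rightarrow> 'a list set" where
  "first_match_words E b d l = {l'. find (\<lambda>a. (b, a) \<in> E) l' = Some d \<and> remove1 d l' = l}"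

lemma first_match_wordsD:
  assumes "l' \<in> first_match_words E b d l"
  shows "(b, d) \<in> E" and "mset l' = add_mset d (mset l)" and "set l' = insert d (set l)"
    and "length l' = Suc (length l)"
proof -
  have f: "find (\<lambda>a. (b, a) \<in> E) l' = Some d" and r: "remove1 d l' = l"
    using assms by (auto simp: first_match_words_def)
  from f show "(b, d) \<in> E" by (auto simp: find_Some_iff)
  from f have "d \<in> set l'" by (auto simp: find_Some_iff)
  with r show m: "mset l' = add_mset d (mset l)" by auto
  show "set l' = insert d (set l)" using arg_cong[OF m, of set_mset] by simp
  show "length l' = Suc (length l)" using arg_cong[OF m, of size] by simp
qed

lemma find_snoc:
  "find Q (l @ [a]) = (case find Q l of Some x \<Rightarrow> Some x | None \<Rightarrow> if Q a then Some a else None)"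
  by (induction l) auto

lemma first_match_words_Nil: "first_match_words E b d [] = (if (b, d) \<in> E then {[d]} else {})"
proof -
  have "l' = [d] \<and> (b, d) \<in> E" if "l' \<in> first_match_words E b d []" for l'
    using first_match_wordsD(1,2)[OF that] by simp
  moreover have "[d] \<in> first_match_words E b d []" if "(b, d) \<in> E"
    using that by (simp add: first_match_words_def)
  ultimately show ?thesis by (auto split: if_splits)
qed

text \<open>Consider the last letter of a predecessor. If \<open>b\<close> finds \<open>d\<close>
  before it, it is the surviving \<open>a\<close>; otherwise it is \<open>d\<close> itself, and then
  \<open>b\<close> matches nothing in \<open>l @ [a]\<close>.\<close>

lemma first_match_words_snoc:
  "first_match_words E b d (l @ [a]) = (\<lambda>l'. l' @ [a]) ` first_match_words E b d l \<union>
     (if (b, d) \<in> E \<and> b \<notin> compatible_servers E (insert a (set l)) then {l @ [a, d]} else {})"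
    (is "?L = ?R")
proof (intro equalityI subsetI)
  fix l' assume l': "l' \<in> ?L"
  then have f: "find (\<lambda>a. (b, a) \<in> E) l' = Some d" and r: "remove1 d l' = l @ [a]"
    by (auto simp: first_match_words_def)
  from f obtain m x where m: "l' = m @ [x]" by (cases l' rule: rev_cases) auto
  show "l' \<in> ?R"
  proof (cases "find (\<lambda>a. (b, a) \<in> E) m")
    case None
    then have x: "x = d" "(b, d) \<in> E" using f by (auto simp: m find_snoc split: if_splits)
    have dm: "d \<notin> set m" using None x by (auto simp: find_None_iff)
    then have "m = l @ [a]" using r by (simp add: m x remove1_append)
    then show ?thesis using None x by (auto simp: m find_None_iff compatible_servers_def)
  next
    case (Some c)
    then have c: "c = d" using f by (simp add: m find_snoc)
    then have "d \<in> set m" using Some by (auto simp: find_Some_iff)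
    then have "remove1 d m = l" "x = a" using r by (auto simp: m remove1_append)
    then show ?thesis using Some c by (auto simp: m first_match_words_def)
  qed
next
  fix l' assume l': "l' \<in> ?R"
  then consider m where "m \<in> first_match_words E b d l" "l' = m @ [a]"
    | "(b, d) \<in> E" "b \<notin> compatible_servers E (insert a (set l))" "l' = l @ [a, d]"
    by (auto split: if_splits)
  then show "l' \<in> ?L"
  proof cases
    case 1
    then have "d \<in> set m" using first_match_wordsD(3) by fastforce
    then show ?thesis using 1 by (auto simp: first_match_words_def find_snoc remove1_append)
  next
    case 2
    then have N: "find (\<lambda>a. (b, a) \<in> E) (l @ [a]) = None"
      by (auto simp: find_None_iff compatible_servers_def)
    then have "find (\<lambda>a. (b, a) \<in> E) ((l @ [a]) @ [d]) = Some d"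
      using 2 by (simp only: find_snoc) simp
    moreover have "d \<notin> set (l @ [a])" using 2 by (auto simp: compatible_servers_def)
    ultimately show ?thesis using 2 by (auto simp: first_match_words_def remove1_append)
  qed
qed

lemma first_match_words_disjoint:
  "d \<noteq> d' \<Longrightarrow> first_match_words E b d l \<inter> first_match_words E b d' l = {}"
  by (auto simp: first_match_words_def)

lemma finite_first_match_words [simp]: "finite (first_match_words E b d l)"
  by (induction l rule: rev_induct) (auto simp: first_match_words_Nil first_match_words_snoc)

lemma sum_UNIV_if_mem:
  fixes f :: "'b::finite \<Rightarrow> real"
  shows "(\<Sum>b\<in>UNIV. if b \<in> A then f b * c else 0) = (\<Sum>b\<in>A. f b) * c"
  by (simp add: sum_distrib_right sum.If_cases)

section \<open>Flow identities for word weights\<close>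

locale compatibility =
  fixes E :: "('b::finite \<times> 'a::finite) set" and \<alpha> :: "'a \<Rightarrow> real" and \<beta> :: "'b \<Rightarrow> real"
  assumes \<alpha>_pos: "\<alpha> a > 0" and \<beta>_pos: "\<beta> b > 0" and compatible: "\<exists>b. (b, a) \<in> E"
begin

lemma compatible_rate_pos: "A \<noteq> {} \<Longrightarrow> (\<Sum>b\<in>compatible_servers E A. \<beta> b) > 0"
  using compatible by (intro sum_pos \<beta>_pos) (auto simp: compatible_servers_def)

lemma word_weight_pos: "word_weight E \<alpha> \<beta> l > 0"
  by (induction l rule: rev_induct) (auto simp: word_weight_snoc \<alpha>_pos compatible_rate_pos)

text \<open>Passing from \<open>l\<close> to \<open>l @ [a]\<close>, insertions before
  \<open>a\<close> scale the old flow by \<open>\<alpha> a / ?M\<close>, which amounts to rate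
  \<open>?N\<close> relative to the weight of \<open>l @ [a]\<close>. Insertion at the end is due to
  the partners that only \<open>d\<close> makes compatible, of rate \<open>?M - ?N\<close>. The
  rates add up to \<open>?M\<close> and cancel the new denominator.\<close>

lemma sum_first_match_words:
  "(\<Sum>b\<in>UNIV. \<beta> b * (\<Sum>l'\<in>first_match_words E b d l. word_weight E \<alpha> \<beta> l'))
    = \<alpha> d * word_weight E \<alpha> \<beta> l"
proof (induction l rule: rev_induct)
  case Nil
  let ?N = "\<Sum>b\<in>compatible_servers E {d}. \<beta> b"
  have "(\<Sum>b\<in>UNIV. \<beta> b * (\<Sum>l'\<in>first_match_words E b d []. word_weight E \<alpha> \<beta> l'))
      = (\<Sum>b\<in>UNIV. if b \<in> compatible_servers E {d} then \<beta> b * (\<alpha> d / ?N) else 0)"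
    using word_weight_snoc[of E \<alpha> \<beta> "[]" d]
    by (intro sum.cong) (auto simp: first_match_words_Nil compatible_servers_def)
  also have "\<dots> = ?N * (\<alpha> d / ?N)"
    by (rule sum_UNIV_if_mem)
  finally show ?case using compatible_rate_pos[of "{d}"] by simp
next
  case (snoc a l)
  let ?W = "word_weight E \<alpha> \<beta>"
  let ?A = "insert a (set l)"
  let ?N = "\<Sum>b\<in>compatible_servers E ?A. \<beta> b"
  let ?M = "\<Sum>b\<in>compatible_servers E (insert d ?A). \<beta> b"
  let ?new = "compatible_servers E (insert d ?A) - compatible_servers E ?A"
  have M: "?M > 0" and N: "?N > 0" by (rule compatible_rate_pos; simp)+
  have "\<beta> b * (\<Sum>l'\<in>first_match_words E b d (l @ [a]). ?W l')
      = \<beta> b * (\<Sum>l'\<in>first_match_words E b d l. ?W l') * (\<alpha> a / ?M)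
        + (if b \<in> ?new then \<beta> b * (?W (l @ [a]) * (\<alpha> d / ?M)) else 0)" for b
  proof -
    let ?F = "(\<lambda>l'. l' @ [a]) ` first_match_words E b d l"
    let ?G = "if (b, d) \<in> E \<and> b \<notin> compatible_servers E ?A then {l @ [a, d]} else {}"
    have new: "b \<in> ?new \<longleftrightarrow> (b, d) \<in> E \<and> b \<notin> compatible_servers E ?A"
      by (auto simp: compatible_servers_def)
    \<comment> \<open>A common word would force \<open>a = d\<close>, yet \<open>b\<close> matches
      \<open>d\<close> and nothing in \<open>l @ [a]\<close>.\<close>
    have disj: "?F \<inter> ?G = {}"
    proof -
      have False if x: "x \<in> ?F" "x \<in> ?G" for x
      proof -
        have G: "x = l @ [a, d]" "(b, d) \<in> E" "b \<notin> compatible_servers E ?A"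
          using x(2) by (simp_all split: if_splits)
        have "a = d" using x(1) unfolding G(1) by force
        then show False using G(2,3) by (simp add: compatible_servers_def)
      qed
      then show ?thesis by blast
    qed
    have "(\<Sum>l'\<in>?F. ?W l') = (\<Sum>l'\<in>first_match_words E b d l. ?W (l' @ [a]))"
      by (subst sum.reindex) (auto simp: inj_on_def)
    \<comment> \<open>Wherever \<open>d\<close> is inserted, the letter set is the same, so the last
      denominator is always \<open>?M\<close>.\<close>
    also have "\<dots> = (\<Sum>l'\<in>first_match_words E b d l. ?W l' * (\<alpha> a / ?M))"
      by (intro sum.cong) (auto simp: word_weight_snoc first_match_wordsD(3) insert_commute)
    finally have F: "(\<Sum>l'\<in>?F. ?W l') = (\<Sum>l'\<in>first_match_words E b d l. ?W l') * (\<alpha> a / ?M)"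
      by (simp only: sum_distrib_right)
    have G: "(\<Sum>l'\<in>?G. ?W l') = (if b \<in> ?new then ?W (l @ [a]) * (\<alpha> d / ?M) else 0)"
      using word_weight_snoc[of E \<alpha> \<beta> "l @ [a]" d] new by simp
    have "(\<Sum>l'\<in>first_match_words E b d (l @ [a]). ?W l') = (\<Sum>l'\<in>?F. ?W l') + (\<Sum>l'\<in>?G. ?W l')"
      unfolding first_match_words_snoc using disj by (intro sum.union_disjoint) auto
    then show ?thesis unfolding F G by (simp add: distrib_left)
  qed
  then have "(\<Sum>b\<in>UNIV. \<beta> b * (\<Sum>l'\<in>first_match_words E b d (l @ [a]). ?W l'))
      = (\<Sum>b\<in>UNIV. \<beta> b * (\<Sum>l'\<in>first_match_words E b d l. ?W l')) * (\<alpha> a / ?M)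
        + (\<Sum>b\<in>UNIV. if b \<in> ?new then \<beta> b * (?W (l @ [a]) * (\<alpha> d / ?M)) else 0)"
    by (simp only: sum.distrib sum_distrib_right)
  also have "\<dots> = \<alpha> d * ?W l * (\<alpha> a / ?M) + (\<Sum>b\<in>?new. \<beta> b) * (?W (l @ [a]) * (\<alpha> d / ?M))"
    by (simp only: snoc.IH sum_UNIV_if_mem)
  also have "?W l * \<alpha> a = ?W (l @ [a]) * ?N"
    using N by (simp add: word_weight_snoc)
  then have "\<alpha> d * ?W l * (\<alpha> a / ?M) = ?N * (?W (l @ [a]) * (\<alpha> d / ?M))"
    by (simp add: field_simps)
  also have "?N * (?W (l @ [a]) * (\<alpha> d / ?M)) + (\<Sum>b\<in>?new. \<beta> b) * (?W (l @ [a]) * (\<alpha> d / ?M))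
      = (?N + (\<Sum>b\<in>?new. \<beta> b)) * (?W (l @ [a]) * (\<alpha> d / ?M))"
    by (rule distrib_right[symmetric])
  also have "?N + (\<Sum>b\<in>?new. \<beta> b) = ?M"
    by (subst sum.subset_diff[of "compatible_servers E ?A" "compatible_servers E (insert d ?A)"])
      (auto simp: compatible_servers_def)
  finally show ?case using M by simp
qed

text \<open>In the queue, \<open>D\<close> consists of the letters that the other list of the state
  permits. The union is disjoint because the word determines the letter that is removed.\<close>

lemma sum_first_match_words_Union:
  "(\<Sum>b\<in>UNIV. \<beta> b * (\<Sum>l'\<in>(\<Union>d\<in>D. first_match_words E b d l). word_weight E \<alpha> \<beta> l'))
    = (\<Sum>d\<in>D. \<alpha> d) * word_weight E \<alpha> \<beta> l"
proof -
  have "(\<Sum>b\<in>UNIV. \<beta> b * (\<Sum>l'\<in>(\<Union>d\<in>D. first_match_words E b d l). word_weight E \<alpha> \<beta> l'))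
      = (\<Sum>b\<in>UNIV. \<Sum>d\<in>D. \<beta> b * (\<Sum>l'\<in>first_match_words E b d l. word_weight E \<alpha> \<beta> l'))"
    by (subst sum.UNION_disjoint) (auto simp: first_match_words_disjoint sum_distrib_left)
  also have "\<dots> = (\<Sum>d\<in>D. \<alpha> d * word_weight E \<alpha> \<beta> l)"
    by (subst sum.swap) (simp only: sum_first_match_words)
  finally show ?thesis by (simp add: sum_distrib_right)
qed

text \<open>This serves the transitions that append a letter: the recursion for the weight, read
  backwards. For the empty word both sides are empty sums.\<close>

lemma sum_butlast:
  "(\<Sum>a\<in>UNIV. \<alpha> a * (\<Sum>l' | l = l' @ [a]. word_weight E \<alpha> \<beta> l'))
    = (\<Sum>b\<in>compatible_servers E (set l). \<beta> b) * word_weight E \<alpha> \<beta> l"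
proof (cases l rule: rev_cases)
  case Nil
  then show ?thesis by (simp add: compatible_servers_def)
next
  case (snoc m c)
  have "{l'. l = l' @ [a]} = (if a = c then {m} else {})" for a
    using snoc by auto
  then have "(\<Sum>a\<in>UNIV. \<alpha> a * (\<Sum>l' | l = l' @ [a]. word_weight E \<alpha> \<beta> l'))
      = (\<Sum>a\<in>UNIV. if a = c then \<alpha> c * word_weight E \<alpha> \<beta> m else 0)"
    by (intro sum.cong) auto
  also have "\<dots> = \<alpha> c * word_weight E \<alpha> \<beta> m" by simp
  finally show ?thesis
    using compatible_rate_pos[of "insert c (set m)"] snoc by (simp add: word_weight_snoc)
qed

section \<open>Summability of the word weights under stability\<close>

text \<open>
  Words are classified by their length and their exact set \<open>C\<close> of letters; removing the last
  letter leaves the set \<open>C\<close> or \<open>C\<close> minus that letter, so that the weights at length \<open>n + 1\<close> are those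
  at length \<open>n\<close> times a ratio \<open>r < 1\<close>, plus terms for smaller sets.
\<close>

lemma summable_weight_by_letters:
  assumes stable: "\<And>A. A \<noteq> {} \<Longrightarrow> (\<Sum>a\<in>A. \<alpha> a) < (\<Sum>b\<in>compatible_servers E A. \<beta> b)"
  shows "summable (\<lambda>n. \<Sum>l | length l = n \<and> set l = C. word_weight E \<alpha> \<beta> l)"
proof -
  define T where "T C n = (\<Sum>l | length l = n \<and> set l = C. word_weight E \<alpha> \<beta> l)" for C n
  have fin: "finite {l :: 'a list. length l = n \<and> Q l}" for n Q
    using finite_lists_length_eq[of "UNIV :: 'a set" n] by (rule finite_subset[rotated]) auto
  have T_nonneg: "T C n \<ge> 0" for C n
    unfolding T_def by (intro sum_nonneg less_imp_le word_weight_pos)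
  have "finite C" by simp
  then have "summable (T C)"
  proof (induction rule: finite_psubset_induct)
    case (psubset C)
    show ?case
    proof (cases "C = {}")
      case True
      \<comment> \<open>Only the empty word has no letters, so the series vanishes from index
        \<open>1\<close> on.\<close>
      have "T C (Suc n) = 0" for n unfolding T_def True by (rule sum.neutral) auto
      then have "summable (\<lambda>n. T C (Suc n))" by simp
      then show ?thesis by (simp only: summable_Suc_iff)
    next
      case False
      let ?M = "\<Sum>b\<in>compatible_servers E C. \<beta> b"
      have M: "?M > 0" using False by (rule compatible_rate_pos)
      define r where "r = (\<Sum>a\<in>C. \<alpha> a) / ?M"
      have r: "r < 1" using stable[OF False] M by (simp add: r_def)
      \<comment> \<open>This collects the words whose last letter is new; their prefixes use a
        smaller letter set, to which the induction hypothesis applies.\<close>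
      define s where "s n = (\<Sum>a\<in>C. \<alpha> a / ?M * T (C - {a}) n)" for n
      have s: "summable s"
        unfolding s_def by (intro summable_sum summable_mult psubset.IH) auto
      have s_nonneg: "s n \<ge> 0" for n
        unfolding s_def using M \<alpha>_pos T_nonneg
        by (intro sum_nonneg mult_nonneg_nonneg divide_nonneg_pos) (auto intro: less_imp_le)
      have step: "T C (Suc n) \<le> r * T C n + s n" for n
      proof -
        let ?L = "\<lambda>a. {l. length l = n \<and> (set l = C \<or> set l = C - {a})}"
        have "{l. length l = Suc n \<and> set l = C} \<subseteq> (\<Union>a\<in>C. (\<lambda>l. l @ [a]) ` ?L a)"
        proof
          fix l assume l: "l \<in> {l. length l = Suc n \<and> set l = C}"
          then obtain m a where m: "l = m @ [a]" by (cases l rule: rev_cases) auto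
          then have "a \<in> C" "m \<in> ?L a" using l by auto
          then show "l \<in> (\<Union>a\<in>C. (\<lambda>l. l @ [a]) ` ?L a)" using m by blast
        qed
        then have "T C (Suc n) \<le> (\<Sum>l\<in>(\<Union>a\<in>C. (\<lambda>l. l @ [a]) ` ?L a). word_weight E \<alpha> \<beta> l)"
          unfolding T_def by (intro sum_mono2) (auto intro: fin less_imp_le word_weight_pos)
        also have "\<dots> = (\<Sum>a\<in>C. \<Sum>l\<in>(\<lambda>l. l @ [a]) ` ?L a. word_weight E \<alpha> \<beta> l)"
          by (rule sum.UNION_disjoint) (auto intro: fin)
        also have "\<dots> = (\<Sum>a\<in>C. \<Sum>l\<in>?L a. word_weight E \<alpha> \<beta> (l @ [a]))"
          by (rule sum.cong[OF refl], subst sum.reindex) (auto simp: inj_on_def)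
        also have "\<dots> = (\<Sum>a\<in>C. \<Sum>l\<in>?L a. \<alpha> a / ?M * word_weight E \<alpha> \<beta> l)"
        proof (rule sum.cong[OF refl], rule sum.cong[OF refl])
          fix a l assume "a \<in> C" "l \<in> ?L a"
          then have "insert a (set l) = C" by blast
          then show "word_weight E \<alpha> \<beta> (l @ [a]) = \<alpha> a / ?M * word_weight E \<alpha> \<beta> l"
            by (simp add: word_weight_snoc)
        qed
        also have "\<dots> = (\<Sum>a\<in>C. \<alpha> a / ?M * (T C n + T (C - {a}) n))"
        proof (intro sum.cong refl)
          fix a assume "a \<in> C"
          have "?L a = {l. length l = n \<and> set l = C} \<union> {l. length l = n \<and> set l = C - {a}}"
            by auto
          then have "(\<Sum>l\<in>?L a. word_weight E \<alpha> \<beta> l) = T C n + T (C - {a}) n"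
            unfolding T_def using \<open>a \<in> C\<close>
            by (simp only:) (rule sum.union_disjoint; auto intro: fin)
          then show "(\<Sum>l\<in>?L a. \<alpha> a / ?M * word_weight E \<alpha> \<beta> l)
              = \<alpha> a / ?M * (T C n + T (C - {a}) n)"
            by (simp only: sum_distrib_left[symmetric])
        qed
        also have "\<dots> = r * T C n + s n"
          by (simp add: distrib_left sum.distrib s_def r_def sum_distrib_right sum_divide_distrib)
        finally show ?thesis .
      qed
      \<comment> \<open>Summing the recursion bounds a partial sum by \<open>r\<close> times itself
        plus a constant; \<open>r < 1\<close> allows solving for it.\<close>
      have bound: "(\<Sum>n<N. T C n) \<le> (T C 0 + suminf s) / (1 - r)" for N
      proof -
        have "(\<Sum>n<N. T C n) \<le> (\<Sum>n<Suc N. T C n)" using T_nonneg by simp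
        also have "\<dots> = T C 0 + (\<Sum>n<N. T C (Suc n))" by (rule sum.lessThan_Suc_shift)
        also have "\<dots> \<le> T C 0 + (\<Sum>n<N. r * T C n + s n)"
          by (intro add_left_mono sum_mono step)
        also have "\<dots> = T C 0 + r * (\<Sum>n<N. T C n) + (\<Sum>n<N. s n)"
          by (simp add: sum.distrib sum_distrib_left)
        also have "(\<Sum>n<N. s n) \<le> suminf s"
          using s s_nonneg by (intro sum_le_suminf) auto
        finally show ?thesis using r by (simp add: field_simps)
      qed
      show ?thesis
        by (rule summableI_nonneg_bounded[OF T_nonneg bound])
    qed
  qed
  then show ?thesis by (simp only: T_def[abs_def])
qed

text \<open>There are finitely many letter sets, so all finite partial sums lie below a finite sum
  of convergent series over the length.\<close>

lemma word_weight_summable: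
  assumes stable: "\<And>A. A \<noteq> {} \<Longrightarrow> (\<Sum>a\<in>A. \<alpha> a) < (\<Sum>b\<in>compatible_servers E A. \<beta> b)"
  shows "word_weight E \<alpha> \<beta> summable_on UNIV"
proof (rule nonneg_bdd_above_summable_on)
  let ?W = "word_weight E \<alpha> \<beta>"
  show "0 \<le> ?W l" for l by (rule less_imp_le, rule word_weight_pos)
  define T where "T C n = (\<Sum>l | length l = n \<and> set l = C. ?W l)" for C n
  have sT: "summable (T C)" for C
    unfolding T_def[abs_def] by (rule summable_weight_by_letters[OF stable])
  have T_nonneg: "T C n \<ge> 0" for C n
    unfolding T_def by (intro sum_nonneg less_imp_le word_weight_pos)
  have fin: "finite {l :: 'a list. length l = n \<and> Q l}" for n Q
    using finite_lists_length_eq[of "UNIV :: 'a set" n] by (rule finite_subset[rotated]) auto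
  have "sum ?W X \<le> (\<Sum>C\<in>UNIV. suminf (T C))" if X: "finite X" for X
  proof -
    define N where "N = Suc (Max (insert 0 (length ` X)))"
    have N: "length l < N" if "l \<in> X" for l
      using X that by (auto simp: N_def less_Suc_eq_le)
    let ?I = "(UNIV :: 'a set set) \<times> {..<N}"
    have "sum ?W X \<le> (\<Sum>l\<in>(\<Union>(C, n)\<in>?I. {l. length l = n \<and> set l = C}). ?W l)"
      using N by (intro sum_mono2) (auto intro: fin less_imp_le word_weight_pos)
    also have "\<dots> = (\<Sum>(C, n)\<in>?I. T C n)"
      unfolding T_def by (subst sum.UNION_disjoint) (auto intro!: fin sum.cong)
    also have "\<dots> = (\<Sum>C\<in>UNIV. \<Sum>n<N. T C n)"
      by (simp add: sum.cartesian_product)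
    also have "\<dots> \<le> (\<Sum>C\<in>UNIV. suminf (T C))"
      using sT T_nonneg by (intro sum_mono sum_le_suminf) auto
    finally show ?thesis .
  qed
  then show "bdd_above (sum ?W ` {F. F \<subseteq> UNIV \<and> finite F})"
    by (intro bdd_aboveI2) auto
qed

end

section \<open>The queue\<close>

text \<open>With no idle server the second factor is \<open>1\<close>, which leaves the product of
  the theorem.\<close>

definition product_weight ::
  "('s \<times> 'c) set \<Rightarrow> ('c \<Rightarrow> real) \<Rightarrow> ('s \<Rightarrow> real) \<Rightarrow> ('c, 's) queue_state \<Rightarrow> real" where
  "product_weight E lam mu x =
     word_weight E lam mu (fst x) * word_weight (E\<inverse>) mu lam (snd x)"

locale fcfs_alis =
  fixes E :: "('s::finite \<times> 'c::finite) set" and lam :: "'c \<Rightarrow> real" and mu :: "'s \<Rightarrow> real"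
  assumes lam_pos: "lam c > 0" and mu_pos: "mu s > 0"
    and server_useful: "\<exists>c. (s, c) \<in> E"
    and stability: "C \<noteq> {} \<Longrightarrow> (\<Sum>c\<in>C. lam c) < (\<Sum>s\<in>compatible_servers E C. mu s)"
begin

text \<open>A type without servers would have compatible rate \<open>0\<close>, against stability
  for its singleton.\<close>

lemma customer_served: "\<exists>s. (s, c) \<in> E"
proof (rule ccontr)
  assume "\<nexists>s. (s, c) \<in> E"
  then have "compatible_servers E {c} = {}" by (auto simp: compatible_servers_def)
  then show False using stability[of "{c}"] lam_pos[of c] by simp
qed

sublocale customers: compatibility E lam mu
  using lam_pos mu_pos customer_served by unfold_locales auto

sublocale servers: compatibility "E\<inverse>" mu lam
  using lam_pos mu_pos server_useful by unfold_locales auto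

abbreviation states :: "('c, 's) queue_state set" where
  "states \<equiv> queue_states E"

abbreviation weight :: "('c, 's) queue_state \<Rightarrow> real" where
  "weight \<equiv> product_weight E lam mu"

abbreviation gen :: "('c, 's) queue_state \<Rightarrow> ('c, 's) queue_state \<Rightarrow> real" where
  "gen \<equiv> fcfs_alis_generator E lam mu"

lemma weight_pos: "weight x > 0"
  unfolding product_weight_def by (intro mult_pos_pos customers.word_weight_pos servers.word_weight_pos)

section \<open>Finiteness and summability over the state space\<close>

lemma length_idle_le: "(ws, ids) \<in> states \<Longrightarrow> length ids \<le> CARD('s)"
  using card_mono[of UNIV "set ids"] by (auto simp: queue_states_def distinct_card)

lemma finite_short_states: "finite {x \<in> states. length (fst x) \<le> n}"
proof (rule finite_subset)
  show "{x \<in> states. length (fst x) \<le> n}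
      \<subseteq> {ws. set ws \<subseteq> UNIV \<and> length ws \<le> n} \<times> {ids. set ids \<subseteq> UNIV \<and> length ids \<le> CARD('s)}"
    using length_idle_le by auto
qed (intro finite_cartesian_product finite_lists_length_le; simp)

text \<open>Forgetting the compatibility constraint embeds the states into pairs of an arbitrary
  word and one of finitely many idle lists, so only the customer factor is summed over an infinite
  set.\<close>

lemma weight_summable: "weight summable_on states"
proof (rule nonneg_bdd_above_summable_on)
  let ?U = "word_weight E lam mu" and ?V = "word_weight (E\<inverse>) mu lam"
  let ?D = "{ids :: 's list. set ids \<subseteq> UNIV \<and> length ids \<le> CARD('s)}"
  have D: "finite ?D" by (rule finite_lists_length_le) simp
  show "0 \<le> weight x" for x by (rule less_imp_le, rule weight_pos)
  have "sum weight X \<le> infsum ?U UNIV * sum ?V ?D" if X: "finite X" "X \<subseteq> states" for X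
  proof -
    have "X \<subseteq> fst ` X \<times> ?D"
      using X(2) length_idle_le by force
    then have "sum weight X \<le> sum weight (fst ` X \<times> ?D)"
      using X(1) D by (intro sum_mono2) (auto intro: less_imp_le weight_pos)
    also have "\<dots> = (\<Sum>ws\<in>fst ` X. \<Sum>ids\<in>?D. ?U ws * ?V ids)"
      by (simp add: product_weight_def sum.cartesian_product case_prod_beta)
    also have "\<dots> = sum ?U (fst ` X) * sum ?V ?D"
      by (rule sum_product[symmetric])
    also have "\<dots> \<le> infsum ?U UNIV * sum ?V ?D"
    proof (rule mult_right_mono)
      show "sum ?U (fst ` X) \<le> infsum ?U UNIV"
        using X(1) customers.word_weight_summable[OF stability]
        by (intro finite_sum_le_infsum) (auto intro: less_imp_le customers.word_weight_pos)
      show "0 \<le> sum ?V ?D" by (intro sum_nonneg less_imp_le servers.word_weight_pos)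
    qed
    finally show ?thesis .
  qed
  then show "bdd_above (sum weight ` {F. F \<subseteq> states \<and> finite F})"
    by (intro bdd_aboveI2) auto
qed

text \<open>The two images are predecessors that differ from the target in the queue or in the idle
  list. The length condition keeps them apart, and in each one factor stays constant.\<close>

lemma sum_weight_Un:
  assumes "finite L" "finite M" and "\<And>l. l \<in> L \<Longrightarrow> length l \<noteq> length ws"
  shows "sum weight ((\<lambda>l. (l, ids)) ` L \<union> (\<lambda>l. (ws, l)) ` M)
    = sum (word_weight E lam mu) L * word_weight (E\<inverse>) mu lam ids
      + word_weight E lam mu ws * sum (word_weight (E\<inverse>) mu lam) M"
proof -
  have "sum weight ((\<lambda>l. (l, ids)) ` L \<union> (\<lambda>l. (ws, l)) ` M)
      = sum weight ((\<lambda>l. (l, ids)) ` L) + sum weight ((\<lambda>l. (ws, l)) ` M)"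
    using assms by (intro sum.union_disjoint) auto
  then show ?thesis
    by (simp add: sum.reindex inj_on_def product_weight_def sum_distrib_left sum_distrib_right)
qed

text \<open>
  Transitions in which a completing server takes a customer of type \<open>d\<close> contribute the arrival rate
  of \<open>d\<close> for the types \<open>d\<close> incompatible with all idle servers; transitions in which it becomes idle
  contribute the total rate of the remaining types. Arrivals are treated symmetrically below.
\<close>

lemma completion_inflow:
  assumes y: "(ws, ids) \<in> states"
  shows "(\<Sum>c\<in>UNIV. lam c) * weight (ws, ids) \<le>
    (\<Sum>s\<in>UNIV. mu s * (\<Sum>x | x \<in> states \<and> length (fst x) \<le> Suc (length ws) \<and>
        s \<notin> set (snd x) \<and> after_completion E s x = (ws, ids). weight x))"
proof -
  let ?U = "word_weight E lam mu" and ?V = "word_weight (E\<inverse>) mu lam"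
  \<comment> \<open>No type that an idle server can serve may have been waiting while
    \<open>ids\<close> were idle; hence \<open>L\<close> takes its letters outside
    \<open>N\<close>.\<close>
  define N where "N = compatible_servers (E\<inverse>) (set ids)"
  define L where "L s = (\<Union>d\<in>- N. first_match_words E s d ws)" for s
  define M where "M s = {l. ids = l @ [s]}" for s
  have M_fin: "finite (M s)" for s
    by (rule finite_subset[of _ "{butlast ids}"]) (auto simp: M_def)
  \<comment> \<open>One inclusion gives the lower bound on the inflow that \<open>balance\<close>
    uses.\<close>
  have sub: "(\<lambda>l. (l, ids)) ` L s \<union> (\<lambda>l. (ws, l)) ` M s \<subseteq>
      {x. x \<in> states \<and> length (fst x) \<le> Suc (length ws) \<and>
        s \<notin> set (snd x) \<and> after_completion E s x = (ws, ids)}" for s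
  proof -
    have "(l, ids) \<in> states \<and> length l \<le> Suc (length ws) \<and> s \<notin> set ids \<and>
        after_completion E s (l, ids) = (ws, ids)"
      if d: "d \<notin> N" and l: "l \<in> first_match_words E s d ws" for l d
    proof -
      note D = first_match_wordsD[OF l]
      have "(s', d) \<notin> E" if "s' \<in> set ids" for s'
        using d that by (auto simp: N_def compatible_servers_def)
      then show ?thesis
        using D y l by (auto simp: queue_states_def first_match_words_def)
    qed
    moreover have "(ws, l) \<in> states \<and> s \<notin> set l \<and> after_completion E s (ws, l) = (ws, ids)"
      if l: "ids = l @ [s]" for l
    proof -
      have "find (\<lambda>c. (s, c) \<in> E) ws = None"
        using y l by (auto simp: find_None_iff queue_states_def)
      then show ?thesis using y l by (auto simp: queue_states_def)
    qed
    ultimately show ?thesis by (auto simp: L_def M_def)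
  qed
  have split: "(\<Sum>c\<in>UNIV. lam c) = (\<Sum>c\<in>- N. lam c) + (\<Sum>c\<in>N. lam c)"
    by (rule sum.subset_diff[of N UNIV, simplified Compl_eq_Diff_UNIV[symmetric]]) auto
  have "(\<Sum>c\<in>UNIV. lam c) * weight (ws, ids)
      = (\<Sum>s\<in>UNIV. mu s * sum ?U (L s)) * ?V ids + ?U ws * (\<Sum>s\<in>UNIV. mu s * sum ?V (M s))"
    unfolding L_def M_def customers.sum_first_match_words_Union servers.sum_butlast split
    by (simp add: N_def product_weight_def algebra_simps)
  also have "\<dots> = (\<Sum>s\<in>UNIV. mu s * (sum ?U (L s) * ?V ids + ?U ws * sum ?V (M s)))"
    by (simp add: sum_distrib_left sum_distrib_right sum.distrib algebra_simps)
  also have "\<dots> = (\<Sum>s\<in>UNIV. mu s * sum weight ((\<lambda>l. (l, ids)) ` L s \<union> (\<lambda>l. (ws, l)) ` M s))"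
    by (subst sum_weight_Un) (auto simp: M_fin L_def dest: first_match_wordsD(4))
  also have "\<dots> \<le> (\<Sum>s\<in>UNIV. mu s * (\<Sum>x | x \<in> states \<and> length (fst x) \<le> Suc (length ws) \<and>
        s \<notin> set (snd x) \<and> after_completion E s x = (ws, ids). weight x))"
    using sub by (intro sum_mono mult_left_mono sum_mono2 finite_subset[OF _ finite_short_states])
      (auto intro: less_imp_le mu_pos weight_pos)
  finally show ?thesis .
qed

lemma arrival_inflow:
  assumes y: "(ws, ids) \<in> states"
  shows "(\<Sum>s\<in>- set ids. mu s) * weight (ws, ids) \<le>
    (\<Sum>c\<in>UNIV. lam c * (\<Sum>x | x \<in> states \<and> length (fst x) \<le> Suc (length ws) \<and>
        after_arrival E c x = (ws, ids). weight x))"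
proof -
  let ?U = "word_weight E lam mu" and ?V = "word_weight (E\<inverse>) mu lam"
  define N where "N = compatible_servers E (set ws)"
  define L where "L c = {l. ws = l @ [c]}" for c
  \<comment> \<open>Here the symmetry with completions breaks: idle servers are distinct, so those
    already in \<open>ids\<close> are excluded as well.\<close>
  define M where "M c = (\<Union>s\<in>- (N \<union> set ids). first_match_words (E\<inverse>) c s ids)" for c
  have L_fin: "finite (L c)" for c
    by (rule finite_subset[of _ "{butlast ws}"]) (auto simp: L_def)
  have sub: "(\<lambda>l. (l, ids)) ` L c \<union> (\<lambda>l. (ws, l)) ` M c \<subseteq>
      {x. x \<in> states \<and> length (fst x) \<le> Suc (length ws) \<and> after_arrival E c x = (ws, ids)}" for c
  proof -
    have "(ws, l) \<in> states \<and> after_arrival E c (ws, l) = (ws, ids)"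
      if s: "s \<notin> N" "s \<notin> set ids" and l: "l \<in> first_match_words (E\<inverse>) c s ids" for l s
    proof -
      note D = first_match_wordsD[OF l]
      have "distinct l"
        using s y mset_eq_imp_distinct_iff[of l "s # ids"] D(2) by (auto simp: queue_states_def)
      moreover have "(s, c') \<notin> E" if "c' \<in> set ws" for c'
        using s that by (auto simp: N_def compatible_servers_def)
      ultimately show ?thesis
        using D(3) y l by (auto simp: queue_states_def first_match_words_def)
    qed
    moreover have "(l, ids) \<in> states \<and> length l \<le> Suc (length ws) \<and>
        after_arrival E c (l, ids) = (ws, ids)"
      if l: "ws = l @ [c]" for l
    proof -
      have "find (\<lambda>s. (s, c) \<in> E) ids = None"
        using y l by (auto simp: find_None_iff queue_states_def)
      then show ?thesis using y l by (auto simp: queue_states_def)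
    qed
    ultimately show ?thesis by (auto simp: L_def M_def)
  qed
  \<comment> \<open>No idle server can serve a waiting customer, so the busy servers are those in
    \<open>N\<close> and those outside both \<open>N\<close> and \<open>ids\<close>.\<close>
  have "N \<inter> set ids = {}"
    using y by (auto simp: N_def compatible_servers_def queue_states_def)
  then have "- set ids = - (N \<union> set ids) \<union> N" by auto
  then have split: "(\<Sum>s\<in>- set ids. mu s) = (\<Sum>s\<in>- (N \<union> set ids). mu s) + (\<Sum>s\<in>N. mu s)"
    by (simp only:) (rule sum.union_disjoint; auto)
  have "(\<Sum>s\<in>- set ids. mu s) * weight (ws, ids)
      = (\<Sum>c\<in>UNIV. lam c * sum ?U (L c)) * ?V ids + ?U ws * (\<Sum>c\<in>UNIV. lam c * sum ?V (M c))"
    unfolding L_def M_def servers.sum_first_match_words_Union customers.sum_butlast split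
    by (simp add: N_def product_weight_def algebra_simps)
  also have "\<dots> = (\<Sum>c\<in>UNIV. lam c * (sum ?U (L c) * ?V ids + ?U ws * sum ?V (M c)))"
    by (simp add: sum_distrib_left sum_distrib_right sum.distrib algebra_simps)
  also have "\<dots> = (\<Sum>c\<in>UNIV. lam c * sum weight ((\<lambda>l. (l, ids)) ` L c \<union> (\<lambda>l. (ws, l)) ` M c))"
    by (subst sum_weight_Un) (auto simp: L_fin M_def, auto simp: L_def)
  also have "\<dots> \<le> (\<Sum>c\<in>UNIV. lam c * (\<Sum>x | x \<in> states \<and> length (fst x) \<le> Suc (length ws) \<and>
        after_arrival E c x = (ws, ids). weight x))"
    using sub by (intro sum_mono mult_left_mono sum_mono2 finite_subset[OF _ finite_short_states])
      (auto intro: less_imp_le lam_pos weight_pos)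
  finally show ?thesis .
qed

text \<open>
  A transition shortens the queue by at most one customer, so the sum includes all predecessors
  of \<open>y\<close>. It is in fact \<open>0\<close>, but the inequality is all that stationarity needs.
\<close>

lemma balance:
  assumes y: "y \<in> states"
  shows "(\<Sum>x | x \<in> states \<and> length (fst x) \<le> Suc (length (fst y)). weight x * gen x y) \<ge> 0"
proof -
  obtain ws ids where y_eq: "y = (ws, ids)" by (cases y)
  define F where "F = {x. x \<in> states \<and> length (fst x) \<le> Suc (length ws)}"
  have F: "finite F" "y \<in> F" using finite_short_states y by (auto simp: F_def y_eq)
  have sub: "(\<Sum>x\<in>F. if Q x then weight x else 0) = (\<Sum>x | x \<in> F \<and> Q x. weight x)" for Q
    using F(1) by (simp add: sum.inter_filter)
  have gen: "gen x y = (\<Sum>c\<in>UNIV. if after_arrival E c x = y then lam c else 0)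
      + (\<Sum>s\<in>UNIV. if s \<notin> set (snd x) \<and> after_completion E s x = y then mu s else 0)
      - (if x = y then (\<Sum>c\<in>UNIV. lam c) + (\<Sum>s\<in>- set ids. mu s) else 0)" for x
    unfolding fcfs_alis_generator_def
    by (auto simp: sum.inter_filter[symmetric] y_eq Compl_eq)
  have "(\<Sum>x\<in>F. weight x * (\<Sum>c\<in>UNIV. if after_arrival E c x = y then lam c else 0))
      = (\<Sum>c\<in>UNIV. lam c * (\<Sum>x\<in>F. if after_arrival E c x = y then weight x else 0))"
    unfolding sum_distrib_left by (subst sum.swap) (intro sum.cong; simp)
  moreover have "(\<Sum>x\<in>F. weight x *
        (\<Sum>s\<in>UNIV. if s \<notin> set (snd x) \<and> after_completion E s x = y then mu s else 0))
      = (\<Sum>s\<in>UNIV. mu s *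
        (\<Sum>x\<in>F. if s \<notin> set (snd x) \<and> after_completion E s x = y then weight x else 0))"
    unfolding sum_distrib_left by (subst sum.swap) (intro sum.cong; simp)
  moreover have "(\<Sum>x\<in>F. weight x * (if x = y then (\<Sum>c\<in>UNIV. lam c) + (\<Sum>s\<in>- set ids. mu s) else 0))
      = weight y * ((\<Sum>c\<in>UNIV. lam c) + (\<Sum>s\<in>- set ids. mu s))"
    using F by (simp add: if_distrib[of "\<lambda>r. _ * r"] cong: if_cong)
  ultimately have "(\<Sum>x\<in>F. weight x * gen x y)
      = (\<Sum>c\<in>UNIV. lam c * (\<Sum>x | x \<in> F \<and> after_arrival E c x = y. weight x))
        + (\<Sum>s\<in>UNIV. mu s * (\<Sum>x | x \<in> F \<and> s \<notin> set (snd x) \<and> after_completion E s x = y. weight x))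
        - weight y * ((\<Sum>c\<in>UNIV. lam c) + (\<Sum>s\<in>- set ids. mu s))"
    unfolding gen sub[symmetric] by (simp only: right_diff_distrib distrib_left sum.distrib sum_subtractf)
  then show ?thesis
    using completion_inflow[of ws ids] arrival_inflow[of ws ids] y
    by (simp add: F_def y_eq distrib_left mult.commute conj_assoc)
qed

lemma gen_diag_bounded: "- ((\<Sum>c\<in>UNIV. lam c) + (\<Sum>s\<in>UNIV. mu s)) \<le> gen x x"
proof -
  have "(\<Sum>s | s \<notin> set (snd x). mu s) \<le> (\<Sum>s\<in>UNIV. mu s)"
    by (intro sum_mono2) (auto intro: less_imp_le mu_pos)
  moreover have "(\<Sum>c | after_arrival E c x = x. lam c) \<ge> 0"
    "(\<Sum>s | s \<notin> set (snd x) \<and> after_completion E s x = x. mu s) \<ge> 0"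
    by (intro sum_nonneg less_imp_le lam_pos mu_pos)+
  ultimately show ?thesis by (simp add: fcfs_alis_generator_def)
qed

section \<open>Reachability of the empty state and the stationary distribution\<close>

lemma gen_pos:
  assumes "x \<noteq> y"
    and "(\<exists>c. after_arrival E c x = y) \<or> (\<exists>s. s \<notin> set (snd x) \<and> after_completion E s x = y)"
  shows "gen x y > 0"
proof -
  have nn: "(\<Sum>c | after_arrival E c x = y. lam c) \<ge> 0"
    "(\<Sum>s | s \<notin> set (snd x) \<and> after_completion E s x = y. mu s) \<ge> 0"
    by (intro sum_nonneg less_imp_le lam_pos mu_pos)+
  from assms(2) have "(\<Sum>c | after_arrival E c x = y. lam c) > 0 \<or>
      (\<Sum>s | s \<notin> set (snd x) \<and> after_completion E s x = y. mu s) > 0"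
  proof (elim disjE exE)
    fix c assume "after_arrival E c x = y"
    then show ?thesis by (intro disjI1 sum_pos lam_pos) auto
  next
    fix s assume "s \<notin> set (snd x) \<and> after_completion E s x = y"
    then show ?thesis by (intro disjI2 sum_pos mu_pos) auto
  qed
  then show ?thesis using nn assms(1) by (auto simp: fcfs_alis_generator_def)
qed

text \<open>Arrivals compatible with the longest idle server occupy the idle servers one by one
  without lengthening the queue. The queue is then emptied from the front: a server compatible with
  the oldest customer completes, takes that customer and stays busy.\<close>

lemma reach_empty:
  assumes chain: "fcfs_alis_chain E lam mu P" and x: "x \<in> states"
  shows "\<exists>t\<ge>0. P t x ([], []) > 0"
proof -
  interpret transition_semigroup states P
    using chain by unfold_locales (simp add: fcfs_alis_chain_def)
  have gen: "has_generator states P gen"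
    using chain by (simp add: fcfs_alis_chain_def)
  have empty: "([], []) \<in> states" by (simp add: queue_states_def)
  have drain: "\<exists>t\<ge>0. P t (ws, []) ([], []) > 0" for ws
  proof (induction ws rule: length_induct)
    case (1 ws)
    show ?case
    proof (cases ws)
      case Nil
      have "P 0 ([], []) ([], []) > 0" using empty at_0[of "([], [])" "([], [])"] by simp
      then show ?thesis using Nil by (intro exI[of _ 0]) simp
    next
      case (Cons w ws')
      obtain s where s: "(s, w) \<in> E" using customer_served by blast
      let ?y = "(ws', []) :: ('c, 's) queue_state"
      have step: "after_completion E s (ws, []) = ?y" using s Cons by simp
      have ne: "(ws, []) \<noteq> ?y" using Cons by simp
      show ?thesis
      proof (rule reach_step[OF gen _ _ empty ne])
        show "gen (ws, []) ?y > 0"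
          using ne by (rule gen_pos) (intro disjI2 exI[of _ s] conjI step; simp)
        show "\<exists>t\<ge>0. P t ?y ([], []) > 0"
          using "1.IH" Cons by simp
      qed (simp_all add: queue_states_def)
    qed
  qed
  have "(ws, ids) \<in> states \<Longrightarrow> \<exists>t\<ge>0. P t (ws, ids) ([], []) > 0" for ws ids
  proof (induction ids rule: length_induct)
    case (1 ids)
    show ?case
    proof (cases ids)
      case Nil
      then show ?thesis using drain by simp
    next
      case (Cons s ids')
      obtain c where c: "(s, c) \<in> E" using server_useful by blast
      let ?y = "(ws, ids')"
      have step: "after_arrival E c (ws, ids) = ?y" using c Cons by simp
      have y: "?y \<in> states" using "1.prems" Cons by (simp add: queue_states_def)
      have ne: "(ws, ids) \<noteq> ?y" using Cons by simp
      show ?thesis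
      proof (rule reach_step[OF gen "1.prems" y empty ne])
        show "gen (ws, ids) ?y > 0"
          using ne by (rule gen_pos) (intro disjI1 exI[of _ c] step)
        show "\<exists>t\<ge>0. P t ?y ([], []) > 0"
          using "1.IH" Cons y by simp
      qed
    qed
  qed
  then show ?thesis using x by (cases x) auto
qed

theorem stationary_product_form:
  assumes chain: "fcfs_alis_chain E lam mu P"
  obtains p Z where "Z > 0" and "\<And>x. pmf p x = (if x \<in> states then weight x / Z else 0)"
    and "\<And>q. stationary_distribution states P q \<longleftrightarrow> q = p"
proof -
  interpret transition_semigroup states P
    using chain by unfold_locales (simp add: fcfs_alis_chain_def)
  have gen: "has_generator states P gen"
    using chain by (simp add: fcfs_alis_chain_def)
  have empty: "([], []) \<in> states" by (simp add: queue_states_def)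
  define Z where "Z = infsum weight states"
  have "weight ([], []) \<le> Z"
    unfolding Z_def using finite_sum_le_infsum[OF weight_summable, of "{([], [])}"] empty
    by (auto intro: less_imp_le weight_pos)
  then have Z: "Z > 0" using weight_pos[of "([], [])"] by linarith
  have "(weight has_sum Z) states"
    unfolding Z_def using weight_summable by simp
  then have "((\<lambda>x. weight x / Z) has_sum (Z / Z)) states"
    unfolding divide_inverse by (rule has_sum_cmult_left)
  then have sum: "((\<lambda>x. weight x / Z) has_sum 1) states" using Z by simp
  define p where "p = embed_pmf (\<lambda>x. if x \<in> states then weight x / Z else 0)"
  have pmf_p: "pmf p x = (if x \<in> states then weight x / Z else 0)" for x
    unfolding p_def using Z weight_pos
    by (intro pmf_embed_pmf_has_sum[OF sum]) (auto intro: less_imp_le)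
  have "stationary_distribution states P p"
  proof (rule stationary_if_balance[OF _ gen gen_diag_bounded])
    show "set_pmf p \<subseteq> states" by (auto simp: set_pmf_eq pmf_p)
    fix y assume y: "y \<in> states"
    let ?F = "{x \<in> states. length (fst x) \<le> Suc (length (fst y))}"
    have "(\<Sum>x\<in>?F. pmf p x * gen x y) = (\<Sum>x\<in>?F. weight x * gen x y) / Z"
      by (simp add: pmf_p sum_divide_distrib)
    then have "(\<Sum>x\<in>?F. pmf p x * gen x y) \<ge> 0"
      using balance[OF y] Z by simp
    then show "\<exists>F. finite F \<and> F \<subseteq> states \<and> y \<in> F \<and> (\<Sum>x\<in>F. pmf p x * gen x y) \<ge> 0"
      using finite_short_states y by (intro exI[of _ ?F]) auto
  qed
  then have "stationary_distribution states P q \<longleftrightarrow> q = p" for q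
    using stationary_unique[OF empty reach_empty[OF chain]] by blast
  then show ?thesis using that Z pmf_p by blast
qed

end

theorem corollary1:
  fixes E :: "('s::finite \<times> 'c::finite) set"
    and lam :: "'c \<Rightarrow> real"
    and mu :: "'s \<Rightarrow> real"
    and P :: "real \<Rightarrow> ('c, 's) queue_state \<Rightarrow> ('c, 's) queue_state \<Rightarrow> real"
  assumes lam_pos: "\<And>c. lam c > 0"
    and mu_pos: "\<And>s. mu s > 0"
    and server_useful: "\<And>s. \<exists>c. (s, c) \<in> E"
    and stability: "\<And>C. C \<noteq> {} \<Longrightarrow> (\<Sum>c\<in>C. lam c) < (\<Sum>s\<in>compatible_servers E C. mu s)"
    and chain: "fcfs_alis_chain E lam mu P"
  shows "(\<exists>!\<pi>. stationary_distribution (queue_states E) P \<pi>) \<and>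
    (\<forall>\<pi>. stationary_distribution (queue_states E) P \<pi> \<longrightarrow>
       \<P>(x in measure_pmf \<pi>. all_busy x) > 0 \<and>
       (\<exists>B>0. \<forall>cs. \<P>(x in measure_pmf \<pi>. x = (cs, []) \<bar> all_busy x) =
          B * (\<Prod>l<length cs. lam (cs ! l) /
                 (\<Sum>s\<in>compatible_servers E (set (take (Suc l) cs)). mu s))))"
proof -
  interpret fcfs_alis E lam mu
    using assms(1-4) by (rule fcfs_alis.intro)
  obtain p Z where Z: "Z > 0" and p: "\<And>x. pmf p x = (if x \<in> states then weight x / Z else 0)"
    and unique: "\<And>q. stationary_distribution states P q \<longleftrightarrow> q = p"
    using stationary_product_form[OF chain] by metis
  let ?b = "\<P>(x in measure_pmf p. all_busy x)"
  have pmf_busy: "pmf p (cs, []) = word_weight E lam mu cs / Z" for cs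
    by (simp add: p queue_states_def product_weight_def)
  have busy: "?b > 0"
  proof -
    have "0 < pmf p ([], [])" using Z by (simp add: pmf_busy)
    also have "\<dots> = measure_pmf.prob p {([], [])}" by (simp add: measure_pmf_single)
    also have "\<dots> \<le> ?b" by (intro measure_pmf.finite_measure_mono) (auto simp: all_busy_def)
    finally show ?thesis .
  qed
  \<comment> \<open>\<open>Z\<close> normalizes over all states and \<open>?b\<close> accounts for
    the conditioning; neither depends on \<open>cs\<close>.\<close>
  have "\<P>(x in measure_pmf p. x = (cs, []) \<bar> all_busy x) = 1 / (Z * ?b) * word_weight E lam mu cs"
    for cs
  proof -
    have "{x. x = (cs, []) \<and> all_busy x} = {(cs, [] :: 's list)}" by (auto simp: all_busy_def)
    then have "measure_pmf.prob p {x. x = (cs, []) \<and> all_busy x} = word_weight E lam mu cs / Z"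
      by (simp only: measure_pmf_single pmf_busy)
    then show ?thesis by (simp add: cond_prob_def)
  qed
  then have "\<exists>B>0. \<forall>cs. \<P>(x in measure_pmf p. x = (cs, []) \<bar> all_busy x)
      = B * word_weight E lam mu cs"
    using Z busy by (intro exI[of _ "1 / (Z * ?b)"]) simp
  then show ?thesis
    using busy unfolding word_weight_def by (auto simp: unique)
qed

end
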